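(* For an integer $z$, let \[ f_{z}(X) = X^{4} - zX^{3} - \frac{3z^{6}-16z^{4}+37z^{2}-32}{8} X^{2} - \frac{2z^{9}-19z^{7}+72z^{5}-135z^{3}+96z}{16} X - \frac{3z^{12}-40z^{10}+214z^{8}-576z^{6}+719z^{4}-64z^{2}-512}{256} \in \mathbb{Q}[X]. \] (a) For all $z \in \mathbb{Z}$, $f_{z}(X)$ is irreducible over $\mathbb{Q}$ and its Galois group over $\mathbb{Q}$ is cyclic of order $4$. In addition, suppose that $z^{2}-2$ is squarefree, that $(z^{4}-4z^{2}+8)/4$ is squarefree when $z$ is even, and that $z^{4}-4z^{2}+8$ is squarefree when $z$ is odd. Then $\mathbb{Q}(\vartheta)$ is a monogenic field, where $\vartheta$ is a root of $f_{z}(X)$. (b) If $z \not\equiv 2 \pmod{4}$, then $f_{z}(X) \in \mathbb{Z}[X]$. If moreover $z$ satisfies the squarefree conditions in (a), then $\{1, \vartheta, \vartheta^{2}, \vartheta^{3}\}$ is a $\mathbb{Z}$-basis for the ring of integers of $\mathbb{Q}(\vartheta)$. (c) If $z \equiv 2 \pmod{4}$, then $f_{z}(X-1/2) \in \mathbb{Z}[X]$. If moreover $z$ satisfies the squarefree conditions in (a), then $\{1, \vartheta_{1}, \vartheta_{1}^{2}, \vartheta_{1}^{3}\}$ is a $\mathbb{Z}$-basis for the ring of integers of $\mathbb{Q}(\vartheta_{1})$, where $\vartheta_{1} = \vartheta + 1/2$ is a root of $f_{z}(X-1/2)$.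
   Context: A number field $K$ is called monogenic if there exists $\theta \in \mathcal{O}_K$ such that $\{1,\theta,\dots,\theta^{[K:\mathbb{Q}]-1}\}$ is a $\mathbb{Z}$-basis of the ring of integers $\mathcal{O}_K$ of $K$. *)

theory Defs
  imports
    "HOL-Algebra.Algebra"
    "HOL-Algebra.Algebraic_Closure_Type"
    "HOL-Computational_Algebra.Computational_Algebra"
    "HOL-Number_Theory.Cong"
    Complex_Main
begin

text \<open>Number fields are taken inside \<^typ>\<open>complex\<close>, and
  \<open>\<rat> :: complex set\<close> plays the role of the base field.\<close>

abbreviation \<CC> :: "complex ring"
  where "\<CC> \<equiv> ring_of_type_algebra"

definition adjoin :: "complex set \<Rightarrow> complex set"
  where "adjoin S = generate_field \<CC> (\<rat> \<union> S)"

definition number_field :: "complex set \<Rightarrow> bool"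
  where "number_field K \<longleftrightarrow> subfield K \<CC> \<and> ring.finite_dimension \<CC> \<rat> K"

definition field_degree :: "complex set \<Rightarrow> nat"
  where "field_degree K = ring.dim \<CC> \<rat> K"

definition ring_of_integers :: "complex set \<Rightarrow> complex set"
  where "ring_of_integers K = {x \<in> K. algebraic_int x}"

abbreviation int_scale :: "int \<Rightarrow> complex \<Rightarrow> complex"
  where "int_scale k x \<equiv> of_int k * x"

definition int_basis :: "complex list \<Rightarrow> complex set \<Rightarrow> bool"
  where "int_basis bs M \<longleftrightarrow>
    distinct bs \<and> \<not> Modules.module.dependent int_scale (set bs) \<and>
    Modules.module.span int_scale (set bs) = M"

definition monogenic :: "complex set \<Rightarrow> bool"
  where "monogenic K \<longleftrightarrow> number_field K \<and>
    (\<exists>\<theta> \<in> ring_of_integers K.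
       int_basis (map (\<lambda>i. \<theta> ^ i) [0..<field_degree K]) (ring_of_integers K))"

definition splitting_field :: "rat poly \<Rightarrow> complex set"
  where "splitting_field p = adjoin {x. poly (map_poly of_rat p) x = 0}"

text \<open>The automorphisms are extensional functions (undefined outside the field), as in
  \<^const>\<open>Bij\<close>, so that distinct elements of the carrier are distinct maps on the field.\<close>

definition galois_group :: "rat poly \<Rightarrow> (complex \<Rightarrow> complex) monoid"
  where "galois_group p =
    (let L = splitting_field p in
      BijGroup L \<lparr>carrier :=
        {\<sigma> \<in> Bij L. \<sigma> \<in> ring_hom (\<CC>\<lparr>carrier := L\<rparr>) (\<CC>\<lparr>carrier := L\<rparr>) \<and>
                    (\<forall>q \<in> \<rat>. \<sigma> q = q)}\<rparr>)"

definition integral_poly :: "rat poly \<Rightarrow> bool"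
  where "integral_poly p \<longleftrightarrow> (\<exists>q :: int poly. p = map_poly of_int q)"

definition quartic :: "int \<Rightarrow> rat poly"
  where "quartic z = (let w = rat_of_int z in
    [: - ((3*w^12 - 40*w^10 + 214*w^8 - 576*w^6 + 719*w^4 - 64*w^2 - 512) / 256),
       - ((2*w^9 - 19*w^7 + 72*w^5 - 135*w^3 + 96*w) / 16),
       - ((3*w^6 - 16*w^4 + 37*w^2 - 32) / 8),
       - w,
       1 :])"

text \<open>The \<open>div\<close> is exact: \<open>z^4 - 4 * z^2 + 8\<close> is a multiple of 4 for even \<open>z\<close>.\<close>

definition squarefree_conditions :: "int \<Rightarrow> bool"
  where "squarefree_conditions z \<longleftrightarrow>
    squarefree (z^2 - 2) \<and>
    (even z \<longrightarrow> squarefree ((z^4 - 4*z^2 + 8) div 4)) \<and>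
    (odd z \<longrightarrow> squarefree (z^4 - 4*z^2 + 8))"

end

theory Submission
  imports Defs "Jordan_Normal_Form.Char_Poly"
begin

text \<open>Put \<open>A = z\<^sup>2 - 2\<close> and \<open>D = A\<^sup>2 + 4\<close>. If \<open>d\<^sup>2 = D\<close>, \<open>w\<^sup>2 = 2A(D + Ad)\<close> and \<open>v = (d - A)w/2\<close>, then
  \<open>v\<^sup>2 = 2A(D - Ad)\<close>, and the roots of the quartic are exactly the numbers \<open>(z + zd + w)/4\<close> for the
  possible choices of \<open>d\<close> and \<open>w\<close>. As \<open>D\<close> is not a square, \<open>1, d, w, v\<close> are independent over the
  rationals, and \<open>d \<mapsto> -d\<close>, \<open>w \<mapsto> v\<close>, \<open>v \<mapsto> -w\<close> generates the Galois group.

  Let \<open>r + sd + tw + uv\<close> be an algebraic integer. Traces and norms of its projections to the two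
  eigenspaces of the square of this generator, together with the squarefreeness of \<open>A\<close> and \<open>D\<close> away from 2, bound the
  denominators of \<open>r, s, t, u\<close> by powers of 2. Since the powers of a root are related to \<open>1, d, w, v\<close> by
  a matrix of determinant \<open>-1/32\<close>, the index of the ring generated by the root is a power of 2. It
  is odd as well: for odd \<open>z\<close> the trace form of the power basis is nondegenerate modulo 2, and for even
  \<open>z\<close> the minimal polynomial of \<open>\<vartheta> - z/4\<close> is Eisenstein at 2.\<close>

section \<open>Sums and products of algebraic integers\<close>

no_notation fps_nth (infixl "$" 75)

interpretation int_mod: Modules.module int_scale
  by unfold_locales (simp_all add: algebra_simps)

text \<open>The determinant trick: multiplication by \<open>x\<close> on the generators
  \<open>S\<close> is given by an integer matrix, and the vector of generators is an eigenvector of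
  it for \<open>x\<close>. Hence \<open>x\<close> is a root of a monic integer characteristic
  polynomial.\<close>

lemma algebraic_int_if_stable:
  assumes fin: "finite S" and one: "1 \<in> S"
    and stable: "\<And>s. s \<in> S \<Longrightarrow> x * s \<in> int_mod.span S"
  shows "algebraic_int x"
proof -
  obtain g where g: "bij_betw g {0..<card S} S"
    using ex_bij_betw_nat_finite[OF fin] by blast
  define n where "n = card S"
  have "\<forall>s\<in>S. \<exists>c. x * s = (\<Sum>t\<in>S. of_int (c t) * t)"
    using stable int_mod.span_finite[OF fin] by auto
  then obtain c where c: "\<And>s. s \<in> S \<Longrightarrow> x * s = (\<Sum>t\<in>S. of_int (c s t) * t)"
    by metis
  define B :: "int mat" where "B = mat n n (\<lambda>(i, j). c (g i) (g j))"
  define M :: "complex mat" where "M = map_mat of_int B"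
  define u where "u = vec n g"
  have B: "B \<in> carrier_mat n n" and M: "M \<in> carrier_mat n n"
    by (auto simp: B_def M_def)
  have gS: "g i \<in> S" if "i < n" for i
    using g that by (auto simp: n_def bij_betw_def)
  have "M *\<^sub>v u = x \<cdot>\<^sub>v u"
  proof (rule eq_vecI)
    fix i assume "i < dim_vec (x \<cdot>\<^sub>v u)"
    then have i: "i < n" by (simp add: u_def)
    have "(M *\<^sub>v u) $ i = (\<Sum>j\<in>{0..<n}. of_int (c (g i) (g j)) * g j)"
      using i by (simp add: M_def B_def u_def scalar_prod_def)
    also have "\<dots> = (\<Sum>t\<in>S. of_int (c (g i) t) * t)"
      using sum.reindex_bij_betw[OF g, of "\<lambda>t. of_int (c (g i) t) * t"] by (simp add: n_def)
    also have "\<dots> = x * g i" using c[OF gS[OF i]] by simp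
    finally show "(M *\<^sub>v u) $ i = (x \<cdot>\<^sub>v u) $ i" using i by (simp add: u_def)
  qed (simp add: M_def B_def u_def)
  \<comment> \<open>An eigenvector must be nonzero; here \<open>1 \<in> S\<close> enters.\<close>
  moreover have "u \<noteq> 0\<^sub>v n"
  proof
    assume u0: "u = 0\<^sub>v n"
    obtain i where "i < n" "g i = 1"
      using g one unfolding bij_betw_def n_def by (metis atLeastLessThan_iff imageE)
    then show False using arg_cong[OF u0, of "\<lambda>v. v $ i"] by (simp add: u_def)
  qed
  ultimately have "eigenvalue M x"
    unfolding eigenvalue_def eigenvector_def using M by (intro exI[of _ u]) (auto simp: u_def)
  then have "poly (char_poly M) x = 0"
    using eigenvalue_root_char_poly[OF M] by simp
  moreover have "char_poly M = map_poly of_int (char_poly B)"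
    unfolding M_def by (rule of_int_hom.char_poly_hom[OF B])
  ultimately show ?thesis
    using degree_monic_char_poly[OF B] by (auto simp: algebraic_int_altdef_ipoly)
qed

text \<open>Solves the monic integer equation for its leading term. Positivity of \<open>n\<close>
  guarantees that \<open>x ^ 0 = 1\<close> is among the spanning powers.\<close>

lemma power_in_span_lower_powers:
  assumes "algebraic_int x"
  obtains n where "n > 0" and "x ^ n \<in> int_mod.span ((\<lambda>i. x ^ i) ` {..<n})"
proof -
  obtain p where p: "poly (map_poly of_int p) x = 0" "lead_coeff p = 1"
    using assms by (auto simp: algebraic_int_altdef_ipoly)
  define n where "n = degree p"
  have "n > 0"
  proof (rule ccontr)
    assume "\<not> n > 0"
    then obtain k where "p = [:k:]" using degree_eq_zeroE n_def by auto
    then show False using p by simp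
  qed
  have "0 = (\<Sum>i\<le>n. of_int (coeff p i) * x ^ i)"
    using p by (simp add: poly_altdef n_def)
  also have "\<dots> = x ^ n + (\<Sum>i<n. of_int (coeff p i) * x ^ i)"
    using p by (simp add: n_def lessThan_Suc_atMost[symmetric])
  finally have "x ^ n = - (\<Sum>i<n. of_int (coeff p i) * x ^ i)"
    by (simp add: eq_neg_iff_add_eq_0)
  also have "\<dots> \<in> int_mod.span ((\<lambda>i. x ^ i) ` {..<n})"
    by (intro int_mod.span_neg int_mod.span_sum int_mod.span_scale int_mod.span_base) auto
  finally show ?thesis using that \<open>n > 0\<close> by blast
qed

lemma mult_span_closed:
  assumes "\<And>s. s \<in> S \<Longrightarrow> x * s \<in> int_mod.span T" and "a \<in> int_mod.span S"
  shows "x * a \<in> int_mod.span T"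
  using assms(2)
proof (induction rule: int_mod.span_induct_alt)
  case base
  then show ?case by (simp add: int_mod.span_zero)
next
  case (step c a b)
  have "x * (of_int c * a + b) = of_int c * (x * a) + x * b" by (simp add: algebra_simps)
  then show ?case using step assms(1)
    by (simp add: int_mod.span_add int_mod.span_scale)
qed

text \<open>The monomials \<open>x ^ i * y ^ j\<close> with bounded exponents span a module stable
  under \<open>x\<close> and under \<open>y\<close>: only a product that reaches the top exponent
  needs reducing. The module is then stable under the sum and the product too.\<close>

lemma algebraic_int_plus_times:
  fixes x y :: complex
  assumes "algebraic_int x" and "algebraic_int y"
  shows "algebraic_int (x + y)" and "algebraic_int (x * y)"
proof -
  obtain m where m: "m > 0" "x ^ m \<in> int_mod.span ((\<lambda>i. x ^ i) ` {..<m})"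
    using power_in_span_lower_powers[OF assms(1)] .
  obtain n where n: "n > 0" "y ^ n \<in> int_mod.span ((\<lambda>i. y ^ i) ` {..<n})"
    using power_in_span_lower_powers[OF assms(2)] .
  define S where "S = (\<lambda>(i, j). x ^ i * y ^ j) ` ({..<m} \<times> {..<n})"
  have fin: "finite S" by (simp add: S_def)
  have one: "1 \<in> S" unfolding S_def using m n by (auto intro!: image_eqI[of _ _ "(0, 0)"])
  have mem: "x ^ i * y ^ j \<in> S" if "i < m" "j < n" for i j
    using that by (auto simp: S_def)
  have x: "x * s \<in> int_mod.span S" if "s \<in> S" for s
  proof -
    obtain i j where ij: "i < m" "j < n" "s = x ^ i * y ^ j"
      using \<open>s \<in> S\<close> by (auto simp: S_def)
    show ?thesis
    proof (cases "Suc i = m")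
      case True
      then have "x * s = y ^ j * x ^ m" using ij by auto
      also have "\<dots> \<in> int_mod.span S"
        by (rule mult_span_closed[OF _ m(2)])
          (use ij in \<open>auto intro!: int_mod.span_base mem simp: mult.commute[of "y ^ j"]\<close>)
      finally show ?thesis .
    next
      case False
      then show ?thesis using mem[of "Suc i" j] ij
        by (auto intro!: int_mod.span_base simp: mult.assoc)
    qed
  qed
  have y: "y * s \<in> int_mod.span S" if "s \<in> S" for s
  proof -
    obtain i j where ij: "i < m" "j < n" "s = x ^ i * y ^ j"
      using \<open>s \<in> S\<close> by (auto simp: S_def)
    show ?thesis
    proof (cases "Suc j = n")
      case True
      then have "y * s = x ^ i * y ^ n" using ij by auto
      also have "\<dots> \<in> int_mod.span S"
        by (rule mult_span_closed[OF _ n(2)])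
          (use ij in \<open>auto intro!: int_mod.span_base mem\<close>)
      finally show ?thesis .
    next
      case False
      then show ?thesis using mem[of i "Suc j"] ij
        by (auto intro!: int_mod.span_base simp: mult.left_commute)
    qed
  qed
  show "algebraic_int (x + y)"
    by (rule algebraic_int_if_stable[OF fin one])
      (simp add: distrib_right x y int_mod.span_add)
  show "algebraic_int (x * y)"
    by (rule algebraic_int_if_stable[OF fin one])
      (simp add: mult.assoc mult_span_closed[OF x y])
qed

lemmas algebraic_int_add = algebraic_int_plus_times(1)
lemmas algebraic_int_mult = algebraic_int_plus_times(2)

lemma algebraic_int_diff:
  fixes x y :: complex
  assumes "algebraic_int x" and "algebraic_int y"
  shows "algebraic_int (x - y)"
  using algebraic_int_add[of x "- y"] assms by simp

lemma algebraic_int_pow: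
  fixes x :: complex
  assumes "algebraic_int x"
  shows "algebraic_int (x ^ n)"
  by (induction n) (simp_all add: algebraic_int_mult assms)

lemma algebraic_int_of_rat:
  assumes "algebraic_int (of_rat q :: complex)"
  shows "q \<in> \<int>"
proof -
  obtain n where "of_rat q = (of_int n :: complex)"
    using rational_algebraic_int_is_int[OF assms] by (auto elim: Ints_cases)
  then have "of_rat q = (of_rat (of_int n) :: complex)" by simp
  then show ?thesis by (simp only: of_rat_eq_iff) simp
qed

text \<open>Write \<open>x = a / b\<close> in lowest terms: \<open>b\<^sup>2\<close> divides
  \<open>n * a\<^sup>2\<close> and is coprime to \<open>a\<^sup>2\<close>, so it divides
  \<open>n\<close>. This is how squarefreeness enters the bounds on denominators.\<close>

lemma squarefree_mult_square_Ints:
  fixes x :: rat and n :: int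
  assumes "squarefree n" and "of_int n * x\<^sup>2 \<in> \<int>"
  shows "x \<in> \<int>"
proof -
  obtain a b where ab: "quotient_of x = (a, b)" by fastforce
  then have b: "b > 0" and cop: "coprime a b" and x: "x = of_int a / of_int b"
    using quotient_of_denom_pos quotient_of_coprime quotient_of_div by auto
  obtain k where k: "of_int n * x\<^sup>2 = of_int k" using assms(2) by (auto elim: Ints_cases)
  have "(of_int (n * a\<^sup>2) :: rat) = of_int (k * b\<^sup>2)"
    using k b by (simp add: x field_simps)
  then have "n * a\<^sup>2 = k * b\<^sup>2" by (simp only: of_int_eq_iff)
  then have "b\<^sup>2 dvd n * a\<^sup>2" by simp
  moreover have "coprime (b\<^sup>2) (a\<^sup>2)" using cop by (simp add: coprime_commute)
  ultimately have "b\<^sup>2 dvd n" by (simp add: coprime_dvd_mult_left_iff)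
  then have "b dvd 1" using assms(1) squarefreeD by blast
  then have "b = 1" using b by simp
  then show ?thesis by (simp add: x)
qed

section \<open>The cyclic quartic field in coordinates\<close>

text \<open>For nonzero \<open>m\<close>, \<open>|n|\<close> lies strictly between
  \<open>|m|\<close> and \<open>|m| + 2\<close>, so it is \<open>|m| + 1\<close>, and parity
  fails.\<close>

lemma square_plus_4_nonsquare:
  fixes m n :: int
  assumes "n\<^sup>2 = m\<^sup>2 + 4"
  shows "m = 0"
proof (rule ccontr)
  assume "m \<noteq> 0"
  define M N where "M = \<bar>m\<bar>" and "N = \<bar>n\<bar>"
  have eq: "N\<^sup>2 = M\<^sup>2 + 4" and M: "M \<ge> 1" and N: "N \<ge> 0"
    using assms \<open>m \<noteq> 0\<close> by (auto simp: M_def N_def)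
  have "N > M" using eq power2_less_imp_less[of M N] N by simp
  moreover have "N < M + 2"
    by (rule power2_less_imp_less) (use eq M in \<open>auto simp: power2_eq_square algebra_simps\<close>)
  ultimately have "N = M + 1" by simp
  then have "2 * M = 3" using eq by (simp add: power2_eq_square algebra_simps)
  then show False by presburger
qed

definition quartic_A :: "int \<Rightarrow> rat" where "quartic_A z = (of_int z)\<^sup>2 - 2"
definition quartic_D :: "int \<Rightarrow> rat" where "quartic_D z = (quartic_A z)\<^sup>2 + 4"

lemma quartic_A_nonzero: "quartic_A z \<noteq> 0"
proof
  assume "quartic_A z = 0"
  then have "(of_int (z\<^sup>2) :: rat) = of_int 2" by (simp add: quartic_A_def)
  then have "z\<^sup>2 = 2" by (simp only: of_int_eq_iff)
  then have "z mod 4 = 0 \<or> z mod 4 = 1 \<or> z mod 4 = 2 \<or> z mod 4 = 3" "z\<^sup>2 mod 4 = 2"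
    by presburger+
  then show False by (auto simp: power_mod[symmetric, of z])
qed

lemma quartic_D_nonzero: "quartic_D z \<noteq> 0"
  by (simp add: quartic_D_def add_nonneg_eq_0_iff)

lemma quartic_D_nonsquare: "quartic_D z \<noteq> x\<^sup>2"
proof
  assume x: "quartic_D z = x\<^sup>2"
  have D: "x\<^sup>2 = of_int ((z\<^sup>2 - 2)\<^sup>2 + 4)" using x by (simp add: quartic_D_def quartic_A_def)
  \<comment> \<open>Squarefreeness of \<open>1\<close>: a rational with integral square is an
    integer.\<close>
  have "x \<in> \<int>"
    using squarefree_mult_square_Ints[of 1 x] D by simp
  then obtain n where n: "x = of_int n" by (auto elim: Ints_cases)
  have "n\<^sup>2 = (z\<^sup>2 - 2)\<^sup>2 + 4"
    using D unfolding n of_int_power[symmetric] by (simp only: of_int_eq_iff)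
  then have "z\<^sup>2 - 2 = 0" by (rule square_plus_4_nonsquare)
  then have "quartic_A z = 0" by (simp add: quartic_A_def flip: of_int_power)
  then show False using quartic_A_nonzero by blast
qed

text \<open>The norm form of the quadratic field generated by a root of \<open>D\<close> is
  anisotropic because \<open>D\<close> is not a square.\<close>

lemma norm_form_eq_0:
  assumes "a\<^sup>2 = quartic_D z * b\<^sup>2"
  shows "a = 0 \<and> b = 0"
proof (cases "b = 0")
  case False
  then have "quartic_D z = (a / b)\<^sup>2" using assms by (simp add: power_divide)
  then show ?thesis using quartic_D_nonsquare by blast
qed (use assms in auto)

text \<open>\<open>d\<close> and \<open>w\<close> are arbitrary square roots, not chosen ones: each
  root of the quartic brings its own pair, and everything proved here then applies to it.\<close>

locale cyclic_quartic =
  fixes z :: int and d w :: complex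
  assumes d_sq: "d\<^sup>2 = of_rat (quartic_D z)"
    and w_sq: "w\<^sup>2 = 2 * of_rat (quartic_A z) * (of_rat (quartic_D z) + of_rat (quartic_A z) * d)"
begin

abbreviation A where "A \<equiv> quartic_A z"
abbreviation D where "D \<equiv> quartic_D z"

definition v :: complex where "v = (d - of_rat A) * w / 2"

lemma of_rat_D: "of_rat D = (of_rat A)\<^sup>2 + (4 :: complex)"
  by (simp add: quartic_D_def of_rat_add of_rat_power)

lemma d_w: "d * w = of_rat A * w + 2 * v"
  by (simp add: v_def algebra_simps)

lemma d_v: "d * v = 2 * w - of_rat A * v"
proof -
  have "2 * (d * v) = d\<^sup>2 * w - of_rat A * (d * w)"
    by (simp add: v_def algebra_simps power2_eq_square)
  also have "\<dots> = 2 * (2 * w - of_rat A * v)"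
    unfolding d_sq of_rat_D d_w by (simp add: algebra_simps power2_eq_square)
  finally show ?thesis by (metis mult_left_cancel zero_neq_numeral)
qed

lemma w_v: "w * v = 4 * of_rat A * d"
proof -
  have "2 * (w * v) = (d - of_rat A) * w\<^sup>2"
    by (simp add: v_def algebra_simps power2_eq_square)
  also have "\<dots> = 2 * of_rat A * (of_rat D * d + of_rat A * d\<^sup>2 - of_rat A * of_rat D - (of_rat A)\<^sup>2 * d)"
    unfolding w_sq by (simp add: algebra_simps power2_eq_square)
  also have "\<dots> = 2 * (4 * of_rat A * d)"
    unfolding d_sq of_rat_D by (simp add: algebra_simps power2_eq_square)
  finally show ?thesis by simp
qed

lemma v_sq: "v\<^sup>2 = 2 * of_rat A * (of_rat D - of_rat A * d)"
proof -
  have "2 * v = (d - of_rat A) * w" by (simp add: v_def)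
  then have "2 * v * v = (d - of_rat A) * w * v" by simp
  then have "2 * v\<^sup>2 = d * (w * v) - of_rat A * (w * v)"
    by (simp add: power2_eq_square algebra_simps)
  also have "\<dots> = 2 * (2 * of_rat A * (d\<^sup>2 - of_rat A * d))"
    unfolding w_v by (simp add: algebra_simps power2_eq_square)
  finally show ?thesis unfolding d_sq by simp
qed

section \<open>Coordinates with respect to \<open>1, d, w, v\<close>\<close>

definition el :: "rat \<Rightarrow> rat \<Rightarrow> rat \<Rightarrow> rat \<Rightarrow> complex"
  where "el r s t u = of_rat r + of_rat s * d + of_rat t * w + of_rat u * v"

lemma el_add: "el r s t u + el r' s' t' u' = el (r + r') (s + s') (t + t') (u + u')"
  by (simp add: el_def of_rat_add algebra_simps)

lemma el_diff: "el r s t u - el r' s' t' u' = el (r - r') (s - s') (t - t') (u - u')"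
  by (simp add: el_def of_rat_diff algebra_simps)

lemma el_minus: "- el r s t u = el (- r) (- s) (- t) (- u)"
  by (simp add: el_def of_rat_minus algebra_simps)

lemma el_of_rat: "of_rat q = el q 0 0 0"
  by (simp add: el_def)

lemma el_scale: "of_rat q * el r s t u = el (q * r) (q * s) (q * t) (q * u)"
  by (simp add: el_def of_rat_mult algebra_simps)

lemma el_mult: "el r s t u * el r' s' t' u' =
  el (r * r' + s * s' * D + 2 * A * D * (t * t' + u * u'))
     (r * s' + s * r' + 2 * A\<^sup>2 * (t * t' - u * u') + 4 * A * (t * u' + u * t'))
     (r * t' + t * r' + A * (s * t' + t * s') + 2 * (s * u' + u * s'))
     (r * u' + u * r' + 2 * (s * t' + t * s') - A * (s * u' + u * s'))"
proof -
  have *: "(r + s * d + t * w + u * v) * (r' + s' * d + t' * w + u' * v) =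
    r * r' + s * s' * d\<^sup>2 + t * t' * w\<^sup>2 + u * u' * v\<^sup>2 + (r * s' + s * r') * d
    + (r * t' + t * r') * w + (r * u' + u * r') * v + (s * t' + t * s') * (d * w)
    + (s * u' + u * s') * (d * v) + (t * u' + u * t') * (w * v)"
    for r s t u r' s' t' u'
    by (simp add: algebra_simps power2_eq_square)
  show ?thesis
    unfolding el_def * unfolding d_sq w_sq v_sq d_w d_v w_v
    by (simp add: of_rat_add of_rat_mult of_rat_diff of_rat_power algebra_simps power2_eq_square)
qed

lemma quadratic_eq_0:
  assumes "of_rat a + of_rat b * d = 0"
  shows "a = 0 \<and> b = 0"
proof -
  have "(of_rat a)\<^sup>2 = (of_rat b * d)\<^sup>2"
    using assms by (metis add.inverse_unique power2_minus)
  then have "of_rat (a\<^sup>2) = (of_rat (D * b\<^sup>2) :: complex)"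
    by (simp add: power_mult_distrib d_sq of_rat_power of_rat_mult)
  then have "a\<^sup>2 = D * b\<^sup>2" by (simp only: of_rat_eq_iff)
  then show ?thesis by (rule norm_form_eq_0)
qed

text \<open>If \<open>r + s d = - (t w + u v)\<close>, the squares of both sides lie in the
  quadratic field of \<open>d\<close>; comparing coordinates there gives two rational
  equations.\<close>

lemma el_eq_0: "el r s t u = 0 \<longleftrightarrow> r = 0 \<and> s = 0 \<and> t = 0 \<and> u = 0"
proof
  assume "el r s t u = 0"
  moreover have "el r s t u = el r s 0 0 + el 0 0 t u" by (simp add: el_add)
  ultimately have "(el r s 0 0)\<^sup>2 - (el 0 0 t u)\<^sup>2 = 0"
    by (simp add: add_eq_0_iff)
  then have "of_rat (r\<^sup>2 + s\<^sup>2 * D - 2 * A * D * (t\<^sup>2 + u\<^sup>2))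
    + of_rat (2 * r * s - 2 * A\<^sup>2 * (t\<^sup>2 - u\<^sup>2) - 8 * A * t * u) * d = 0"
    unfolding power2_eq_square el_mult el_diff
    by (simp add: el_def power2_eq_square algebra_simps)
  from quadratic_eq_0[OF this]
  have 1: "r\<^sup>2 + s\<^sup>2 * D = 2 * A * D * (t\<^sup>2 + u\<^sup>2)"
    and 2: "2 * r * s = 2 * A\<^sup>2 * (t\<^sup>2 - u\<^sup>2) + 8 * A * t * u" by simp_all
  \<comment> \<open>The norm of \<open>(r + s d)\<^sup>2\<close>, computed from these equations with
    \<open>D = A\<^sup>2 + 4\<close>, is \<open>D\<close> times a square. As \<open>D\<close> is no
    square, both sides vanish, and then the positive definite \<open>t\<^sup>2 + u\<^sup>2\<close>
    does too.\<close>
  have "(r\<^sup>2 - s\<^sup>2 * D)\<^sup>2 = (r\<^sup>2 + s\<^sup>2 * D)\<^sup>2 - D * (2 * r * s)\<^sup>2"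
    by (simp add: power2_eq_square algebra_simps)
  also have "\<dots> = D * (4 * A * (t\<^sup>2 - u\<^sup>2) - 4 * A\<^sup>2 * t * u)\<^sup>2"
    unfolding 1 2 unfolding quartic_D_def by (simp add: power2_eq_square algebra_simps)
  finally have "r\<^sup>2 - s\<^sup>2 * D = 0" using norm_form_eq_0 by blast
  then have rs: "r = 0 \<and> s = 0" using norm_form_eq_0[of r z s] by (simp add: mult.commute)
  then have "t\<^sup>2 + u\<^sup>2 = 0" using 1 quartic_A_nonzero quartic_D_nonzero by simp
  then show "r = 0 \<and> s = 0 \<and> t = 0 \<and> u = 0" using rs by (simp add: add_nonneg_eq_0_iff)
qed (simp add: el_def)

lemma el_eq_iff: "el r s t u = el r' s' t' u' \<longleftrightarrow> r = r' \<and> s = s' \<and> t = t' \<and> u = u'"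
  using el_eq_0[of "r - r'" "s - s'" "t - t'" "u - u'"] by (simp add: el_diff[symmetric])

section \<open>The field \<open>L\<close> and its automorphism of order four\<close>

definition L :: "complex set" where "L = {el r s t u |r s t u. True}"

lemma el_in_L [simp]: "el r s t u \<in> L"
  by (auto simp: L_def)

lemma L_cases:
  assumes "x \<in> L" obtains r s t u where "x = el r s t u"
  using assms by (auto simp: L_def)

text \<open>The generator \<open>d \<mapsto> -d\<close>, \<open>w \<mapsto> v\<close>,
  \<open>v \<mapsto> -w\<close> in coordinates. Uniqueness of coordinates makes the definite
  description meaningful on \<open>L\<close>; elsewhere its value is unspecified.\<close>

definition sg :: "complex \<Rightarrow> complex"
  where "sg x = (THE y. \<exists>r s t u. x = el r s t u \<and> y = el r (- s) (- u) t)"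

lemma sg_el [simp]: "sg (el r s t u) = el r (- s) (- u) t"
  unfolding sg_def by (rule the_equality) (auto simp: el_eq_iff)

lemma L_add [simp]: "x \<in> L \<Longrightarrow> y \<in> L \<Longrightarrow> x + y \<in> L"
  by (auto elim!: L_cases simp: el_add)

lemma L_uminus [simp]: "x \<in> L \<Longrightarrow> - x \<in> L"
  by (auto elim!: L_cases simp: el_minus)

lemma L_mult [simp]: "x \<in> L \<Longrightarrow> y \<in> L \<Longrightarrow> x * y \<in> L"
  by (auto elim!: L_cases simp: el_mult)

lemma L_of_rat [simp]: "of_rat q \<in> L"
  by (simp add: el_of_rat)

lemma L_of_int [simp]: "of_int n \<in> L"
  using L_of_rat[of "of_int n"] by simp

lemma L_0 [simp]: "0 \<in> L" and L_1 [simp]: "1 \<in> L"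
  using L_of_int[of 0] L_of_int[of 1] by simp_all

lemma L_power [simp]: "x \<in> L \<Longrightarrow> x ^ n \<in> L"
  by (induction n) simp_all

lemma sg_in_L [simp]: "x \<in> L \<Longrightarrow> sg x \<in> L"
  by (auto elim!: L_cases)

lemma sg_add: "x \<in> L \<Longrightarrow> y \<in> L \<Longrightarrow> sg (x + y) = sg x + sg y"
  by (auto elim!: L_cases simp: el_add)

lemma sg_mult: "x \<in> L \<Longrightarrow> y \<in> L \<Longrightarrow> sg (x * y) = sg x * sg y"
  by (auto elim!: L_cases simp: el_mult el_eq_iff algebra_simps)

lemma sg_of_rat [simp]: "sg (of_rat q) = of_rat q"
  by (simp add: el_of_rat)

lemma sg_of_int [simp]: "sg (of_int n) = of_int n"
  using sg_of_rat[of "of_int n"] by simp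

lemma sg_0 [simp]: "sg 0 = 0" and sg_1 [simp]: "sg 1 = 1"
  using sg_of_int[of 0] sg_of_int[of 1] by simp_all

lemma sg_power: "x \<in> L \<Longrightarrow> sg (x ^ n) = sg x ^ n"
  by (induction n) (simp_all add: sg_mult)

lemma sg_4 [simp]: "x \<in> L \<Longrightarrow> sg (sg (sg (sg x))) = x"
  by (auto elim!: L_cases)

lemma sg_fixed: "x \<in> L \<Longrightarrow> sg x = x \<Longrightarrow> x \<in> \<rat>"
  by (auto elim!: L_cases simp: el_eq_iff el_of_rat[symmetric])

lemma poly_of_int_L [simp]: "x \<in> L \<Longrightarrow> poly (map_poly of_int p) x \<in> L"
  by (induction p) (simp_all add: map_poly_pCons)

lemma sg_poly_of_int:
  "x \<in> L \<Longrightarrow> sg (poly (map_poly of_int p) x) = poly (map_poly of_int p) (sg x)"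
  by (induction p) (simp_all add: map_poly_pCons sg_add sg_mult)

text \<open>\<open>x\<close> and \<open>sg x\<close> are roots of the same integer
  polynomials.\<close>

lemma algebraic_int_sg:
  assumes "x \<in> L" and "algebraic_int x"
  shows "algebraic_int (sg x)"
proof -
  obtain p where p: "poly (map_poly of_int p) x = 0" "lead_coeff p = 1"
    using assms by (auto simp: algebraic_int_altdef_ipoly)
  then have "poly (map_poly of_int p) (sg x) = 0"
    using sg_poly_of_int[OF assms(1), of p] by simp
  then show ?thesis using p by (auto simp: algebraic_int_altdef_ipoly)
qed

section \<open>Trace and norm of \<open>L\<close>\<close>

definition tr :: "complex \<Rightarrow> complex" where "tr x = x + sg x + sg (sg x) + sg (sg (sg x))"
definition nm :: "complex \<Rightarrow> complex" where "nm x = x * sg x * sg (sg x) * sg (sg (sg x))"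

text \<open>\<open>sg\<close> permutes the factors cyclically, so it fixes the product.\<close>

lemma nm_Rats: "x \<in> L \<Longrightarrow> nm x \<in> \<rat>"
  by (rule sg_fixed) (simp_all add: nm_def sg_mult mult_ac)

lemma nm_eq_0: "x \<in> L \<Longrightarrow> nm x = 0 \<longleftrightarrow> x = 0"
  by (auto elim!: L_cases simp: nm_def el_eq_0)

text \<open>The inverse is the product of the three other conjugates divided by the rational
  norm.\<close>

lemma L_inverse [simp]:
  assumes "x \<in> L" shows "inverse x \<in> L"
proof (cases "x = 0")
  case False
  obtain q where q: "nm x = of_rat q" using nm_Rats[OF assms] by (auto elim: Rats_cases)
  then have "q \<noteq> 0" using False nm_eq_0[OF assms] by auto
  then have "x * (of_rat (1 / q) * (sg x * sg (sg x) * sg (sg (sg x)))) = 1"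
    using q by (simp add: nm_def of_rat_divide field_simps)
  then have "inverse x = of_rat (1 / q) * (sg x * sg (sg x) * sg (sg (sg x)))"
    by (rule inverse_unique)
  then show ?thesis using assms by simp
qed simp

lemma tr_el: "tr (el r s t u) = of_rat (4 * r)"
  by (simp add: tr_def el_add el_of_rat)

lemma nm_mult: "x \<in> L \<Longrightarrow> y \<in> L \<Longrightarrow> nm (x * y) = nm x * nm y"
  by (simp add: nm_def sg_mult mult_ac)

lemma nm_power: "x \<in> L \<Longrightarrow> nm (x ^ n) = nm x ^ n"
  by (simp add: nm_def sg_power power_mult_distrib)

lemma nm_of_rat: "nm (of_rat q) = of_rat (q ^ 4)"
  by (simp add: nm_def of_rat_mult power4_eq_xxxx)

lemma algebraic_int_nm: "x \<in> L \<Longrightarrow> algebraic_int x \<Longrightarrow> algebraic_int (nm x)"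
  unfolding nm_def by (intro algebraic_int_mult algebraic_int_sg) simp_all

lemma algebraic_int_tr: "x \<in> L \<Longrightarrow> algebraic_int x \<Longrightarrow> algebraic_int (tr x)"
  unfolding tr_def by (intro algebraic_int_add algebraic_int_sg) simp_all

end

section \<open>Generation, degree and irreducibility\<close>

interpretation CC: cring \<CC>
  by (rule cring_from_type_algebra)

lemma field_CC: "field \<CC>"
  by (rule field_from_type_algebra)

lemma CC_simps [simp]:
  "carrier \<CC> = UNIV" "x \<otimes>\<^bsub>\<CC>\<^esub> y = x * y" "x \<oplus>\<^bsub>\<CC>\<^esub> y = x + y" "\<one>\<^bsub>\<CC>\<^esub> = 1" "\<zero>\<^bsub>\<CC>\<^esub> = 0"
  by (simp_all add: ring_of_type_algebra_def)

lemma CC_a_inv [simp]: "\<ominus>\<^bsub>\<CC>\<^esub> x = - x"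
  by (rule CC.minus_equality) simp_all

lemma CC_m_inv [simp]: "x \<noteq> 0 \<Longrightarrow> inv\<^bsub>\<CC>\<^esub> x = inverse x"
  by (rule CC.comm_inv_char) simp_all

lemma subfield_CC_I:
  assumes "1 \<in> K" and "\<And>x. x \<in> K \<Longrightarrow> - x \<in> K" and "\<And>x. x \<in> K \<Longrightarrow> inverse x \<in> K"
    and "\<And>x y. x \<in> K \<Longrightarrow> y \<in> K \<Longrightarrow> x + y \<in> K" and "\<And>x y. x \<in> K \<Longrightarrow> y \<in> K \<Longrightarrow> x * y \<in> K"
  shows "subfield K \<CC>"
  by (rule field.subfieldI'[OF field_CC], rule CC.subringI) (use assms in auto)

lemma subfield_Rats: "subfield \<rat> \<CC>"
  by (rule subfield_CC_I) auto

lemma adjoin_subset: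
  assumes "subfield K \<CC>" and "\<rat> \<subseteq> K" and "S \<subseteq> K"
  shows "adjoin S \<subseteq> K"
  unfolding adjoin_def by (rule field.generate_field_min_subfield1[OF field_CC]) (use assms in auto)

lemma adjoin_base: "x \<in> S \<Longrightarrow> x \<in> adjoin S"
  by (simp add: adjoin_def generate_field.incl)

lemma adjoin_of_rat [simp]: "of_rat q \<in> adjoin S"
  by (simp add: adjoin_def generate_field.incl)

lemma adjoin_add: "x \<in> adjoin S \<Longrightarrow> y \<in> adjoin S \<Longrightarrow> x + y \<in> adjoin S"
  using generate_field.eng_add[of x \<CC> _ y] by (simp add: adjoin_def)

lemma adjoin_mult: "x \<in> adjoin S \<Longrightarrow> y \<in> adjoin S \<Longrightarrow> x * y \<in> adjoin S"
  using generate_field.eng_mult[of x \<CC> _ y] by (simp add: adjoin_def)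

section \<open>Independence of powers and irreducibility\<close>

definition rat_indep :: "complex \<Rightarrow> bool"
  where "rat_indep x \<longleftrightarrow> (\<forall>a b c e. of_rat a + of_rat b * x + of_rat c * x\<^sup>2 + of_rat e * x ^ 3 = 0 \<longrightarrow>
    a = 0 \<and> b = 0 \<and> c = 0 \<and> e = 0)"

text \<open>Expanding in powers of \<open>x\<close> changes the coefficients by a unitriangular
  matrix.\<close>

lemma rat_indep_shift:
  assumes "rat_indep x"
  shows "rat_indep (x + of_rat q)"
  unfolding rat_indep_def
proof (intro allI impI)
  fix a b c e
  assume "of_rat a + of_rat b * (x + of_rat q) + of_rat c * (x + of_rat q)\<^sup>2
    + of_rat e * (x + of_rat q) ^ 3 = 0"
  then have "of_rat (a + b * q + c * q\<^sup>2 + e * q ^ 3) + of_rat (b + 2 * c * q + 3 * e * q\<^sup>2) * x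
    + of_rat (c + 3 * e * q) * x\<^sup>2 + of_rat e * x ^ 3 = 0"
    by (simp add: of_rat_add of_rat_mult of_rat_power algebra_simps power2_eq_square power3_eq_cube)
  then have "a + b * q + c * q\<^sup>2 + e * q ^ 3 = 0 \<and> b + 2 * c * q + 3 * e * q\<^sup>2 = 0
    \<and> c + 3 * e * q = 0 \<and> e = 0"
    using assms unfolding rat_indep_def by blast
  then show "a = 0 \<and> b = 0 \<and> c = 0 \<and> e = 0" by auto
qed

lemma rat_indep_poly:
  assumes "rat_indep x" and "degree p \<le> 3" and "poly (map_poly of_rat p) x = 0"
  shows "p = 0"
proof -
  have "poly q x = (\<Sum>i\<le>3. coeff q i * x ^ i)" if "degree q \<le> 3" for q
    unfolding poly_altdef by (rule sum.mono_neutral_left) (use that in \<open>auto simp: coeff_eq_0\<close>)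
  from this[of "map_poly of_rat p"]
  have "poly (map_poly of_rat p) x = (\<Sum>i\<le>3. of_rat (coeff p i) * x ^ i)"
    using assms(2) by (simp add: coeff_map_poly degree_map_poly)
  then have "of_rat (coeff p 0) + of_rat (coeff p 1) * x + of_rat (coeff p 2) * x\<^sup>2
      + of_rat (coeff p 3) * x ^ 3 = 0"
    using assms(3) by (simp add: numeral_eq_Suc)
  then have c: "coeff p 0 = 0 \<and> coeff p 1 = 0 \<and> coeff p 2 = 0 \<and> coeff p 3 = 0"
    using assms(1) unfolding rat_indep_def by blast
  have "coeff p i = 0" for i
  proof -
    consider "i = 0" | "i = 1" | "i = 2" | "i = 3" | "i > 3" by linarith
    then show ?thesis using c assms(2) by cases (auto intro: coeff_eq_0)
  qed
  then show ?thesis by (simp add: poly_eq_iff)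
qed

text \<open>One factor of \<open>p\<close> vanishes at \<open>x\<close>; by independence its degree
  exceeds 3, so the cofactor is constant.\<close>

lemma irreducible_if_rat_indep_root:
  assumes "rat_indep x" and "degree p = 4" and "poly (map_poly of_rat p) x = 0"
  shows "Factorial_Ring.irreducible (p :: rat poly)"
proof (rule Factorial_Ring.irreducibleI)
  show "p \<noteq> 0" using assms(2) by auto
  show "\<not> p dvd 1" using assms(2) by (auto simp: is_unit_iff_degree poly_dvd_1)
next
  interpret h: map_poly_comm_ring_hom "of_rat :: rat \<Rightarrow> complex" ..
  fix a b assume p: "p = a * b"
  have ne: "a \<noteq> 0" "b \<noteq> 0" using p assms(2) by auto
  then have deg: "degree a + degree b = 4" using p assms(2) by (simp add: degree_mult_eq)
  have "map_poly of_rat p = (map_poly of_rat a * map_poly of_rat b :: complex poly)"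
    unfolding p by (rule h.hom_mult)
  then consider "poly (map_poly of_rat a) x = 0" | "poly (map_poly of_rat b) x = 0"
    using assms(3) by auto
  then show "a dvd 1 \<or> b dvd 1"
  proof cases
    case 1
    then have "degree a > 3" using rat_indep_poly[OF assms(1), of a] ne by force
    then have "degree b = 0" using deg by simp
    then show ?thesis using ne by (simp add: is_unit_iff_degree)
  next
    case 2
    then have "degree b > 3" using rat_indep_poly[OF assms(1), of b] ne by force
    then have "degree a = 0" using deg by simp
    then show ?thesis using ne by (simp add: is_unit_iff_degree)
  qed
qed

text \<open>Together with \<open>depressed_q\<close> and \<open>depressed_r\<close>, the
  coefficients left after translating the quartic by \<open>z/4\<close>, which removes its cubic
  term.\<close>

definition depressed_p :: "int \<Rightarrow> rat" where "depressed_p z = - 1/8 * (quartic_D z * (3 * (of_int z)\<^sup>2 - 4))"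
definition depressed_q :: "int \<Rightarrow> rat" where "depressed_q z = - 1/8 * (quartic_D z * (quartic_A z)\<^sup>2 * of_int z)"
definition depressed_r :: "int \<Rightarrow> rat"
  where "depressed_r z = 1/256 * (quartic_D z * (64 - 40 * of_int z ^ 4 + 20 * of_int z ^ 6 - 3 * of_int z ^ 8))"

context cyclic_quartic
begin

abbreviation Z :: rat where "Z \<equiv> of_int z"

text \<open>The root \<open>(z + zd + w)/4\<close> of the quartic, shifted by \<open>z/4\<close> to remove the cubic term.\<close>

definition nu :: complex where "nu = el 0 (1/4*Z) (1/4) 0"

lemma nu_in_L [simp]: "nu \<in> L" by (simp add: nu_def)

lemma nu_2: "nu\<^sup>2 = el (3/16*Z^6 - Z^4 + 5/2*Z^2 - 2) (1/8*Z^4 - 1/2*Z^2 + 1/2) (1/8*Z^3 - 1/4*Z) (1/4*Z)"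
  unfolding nu_def power2_eq_square[of "el _ _ _ _"] el_mult el_eq_iff quartic_D_def quartic_A_def
  by (intro conjI; Groebner_Basis.algebra)

lemma nu_3: "nu ^ 3 = el (3/32*Z^9 - 3/4*Z^7 + 21/8*Z^5 - 9/2*Z^3 + 3*Z)
  (7/64*Z^7 - 5/8*Z^5 + 13/8*Z^3 - 3/2*Z) (7/64*Z^6 - 9/16*Z^4 + 5/4*Z^2 - 3/4) (1/16*Z^4 - 1/4*Z^2 + 1/4)"
proof -
  have *: "nu ^ 3 = nu * nu\<^sup>2" by (simp add: power_numeral_reduce)
  show ?thesis unfolding * nu_2
    unfolding nu_def el_mult el_eq_iff quartic_D_def quartic_A_def by (intro conjI; Groebner_Basis.algebra)
qed

text \<open>Relations among the powers of \<open>nu\<close>, and between these and \<open>d\<close>,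
  \<open>w\<close>, \<open>v\<close>, become four polynomial identities in \<open>Z\<close>.\<close>

lemma nu_comb: "of_rat a + of_rat b * nu + of_rat c * nu\<^sup>2 + of_rat e * nu ^ 3 =
   el (a + c * (3/16*Z^6 - Z^4 + 5/2*Z^2 - 2) + e * (3/32*Z^9 - 3/4*Z^7 + 21/8*Z^5 - 9/2*Z^3 + 3*Z))
    (1/4 * b * Z + c * (1/8*Z^4 - 1/2*Z^2 + 1/2) + e * (7/64*Z^7 - 5/8*Z^5 + 13/8*Z^3 - 3/2*Z))
    (1/4 * b + c * (1/8*Z^3 - 1/4*Z) + e * (7/64*Z^6 - 9/16*Z^4 + 5/4*Z^2 - 3/4))
    (c * (1/4*Z) + e * (1/16*Z^4 - 1/4*Z^2 + 1/4))"
  unfolding nu_2 nu_3 unfolding nu_def el_scale el_of_rat[of a] el_add el_eq_iff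
  by (intro conjI; Groebner_Basis.algebra)

lemma nu_4: "nu ^ 4 + of_rat (depressed_p z) * nu\<^sup>2 + of_rat (depressed_q z) * nu + of_rat (depressed_r z) = 0"
proof -
  have "nu ^ 4 = nu\<^sup>2 * nu\<^sup>2" by (simp add: power_numeral_reduce)
  \<comment> \<open>The vanishing term \<open>of_rat 0 * nu ^ 3\<close> puts the sum into the shape
    that \<open>nu_comb\<close> rewrites.\<close>
  have "nu\<^sup>2 * nu\<^sup>2 + (of_rat (depressed_r z) + of_rat (depressed_q z) * nu + of_rat (depressed_p z) * nu\<^sup>2 + of_rat 0 * nu ^ 3) = 0"
    unfolding nu_comb unfolding nu_2 el_mult el_add el_eq_0 depressed_p_def depressed_q_def depressed_r_def quartic_D_def quartic_A_def
    by (intro conjI; Groebner_Basis.algebra)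
  then show ?thesis by (simp add: \<open>nu ^ 4 = nu\<^sup>2 * nu\<^sup>2\<close>[symmetric] add_ac)
qed

lemma rat_indep_nu: "rat_indep nu"
  unfolding rat_indep_def
proof (intro allI impI)
  fix a b c e
  define X1 where "X1 = a + c * (3/16*Z^6 - Z^4 + 5/2*Z^2 - 2) + e * (3/32*Z^9 - 3/4*Z^7 + 21/8*Z^5 - 9/2*Z^3 + 3*Z)"
  define X2 where "X2 = 1/4 * b * Z + c * (1/8*Z^4 - 1/2*Z^2 + 1/2) + e * (7/64*Z^7 - 5/8*Z^5 + 13/8*Z^3 - 3/2*Z)"
  define X3 where "X3 = 1/4 * b + c * (1/8*Z^3 - 1/4*Z) + e * (7/64*Z^6 - 9/16*Z^4 + 5/4*Z^2 - 3/4)"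
  define X4 where "X4 = c * (1/4*Z) + e * (1/16*Z^4 - 1/4*Z^2 + 1/4)"
  assume "of_rat a + of_rat b * nu + of_rat c * nu\<^sup>2 + of_rat e * nu ^ 3 = 0"
  then have X: "X1 = 0" "X2 = 0" "X3 = 0" "X4 = 0"
    unfolding nu_comb by (auto simp: el_eq_0 X1_def X2_def X3_def X4_def)
  \<comment> \<open>Two rows of the inverse coordinate matrix. Solving for \<open>e\<close> and
    \<open>c\<close> this way avoids a division by \<open>Z\<close>, which may be zero;
    \<open>b\<close> and \<open>a\<close> then follow by back-substitution.\<close>
  have e: "e = - 2*Z*X2 + 2*Z^2*X3 + (4 - 2*Z^2)*X4"
    unfolding X2_def X3_def X4_def by Groebner_Basis.algebra
  have c: "c = (1/2*Z^4 - 2*Z^2 + 2)*X2 + (- 1/2*Z^5 + 2*Z^3 - 2*Z)*X3 + (1/2*Z^5 - 3*Z^3 + 6*Z)*X4"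
    unfolding X2_def X3_def X4_def by Groebner_Basis.algebra
  have "e = 0" "c = 0" using e c X by simp_all
  then show "a = 0 \<and> b = 0 \<and> c = 0 \<and> e = 0" using X by (simp add: X1_def X3_def)
qed

text \<open>The coefficients below are the rows of the inverse of the matrix expressing \<open>1, \<nu>, \<nu>\<^sup>2, \<nu>\<^sup>3\<close>
  in terms of \<open>1, d, w, v\<close>.\<close>

lemma nu_d: "32 * d = of_int (3*z^10 - 20*z^8 + 52*z^6 - 32*z^4 - 96*z^2 + 128)
  + of_int (20*z^7 - 96*z^5 + 224*z^3 - 128*z) * nu + of_int (16*z^4 - 64*z^2 + 64) * nu\<^sup>2 + of_int (- 64*z) * nu ^ 3"
proof -
  have *: "32 * d = el 0 32 0 0" by (simp add: el_def)
  have i: "(of_int k :: complex) = of_rat (of_int k)" for k by simp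
  show ?thesis unfolding * i nu_comb el_eq_iff of_int_add of_int_diff of_int_mult of_int_power of_int_numeral of_int_minus
    by (intro conjI; Groebner_Basis.algebra)
qed

lemma nu_w: "32 * w = of_int (- 3*z^11 + 20*z^9 - 52*z^7 + 32*z^5 + 96*z^3 - 128*z)
  + of_int (- 20*z^8 + 96*z^6 - 224*z^4 + 128*z^2 + 128) * nu + of_int (- 16*z^5 + 64*z^3 - 64*z) * nu\<^sup>2 + of_int (64*z^2) * nu ^ 3"
proof -
  have *: "32 * w = el 0 0 32 0" by (simp add: el_def)
  have i: "(of_int k :: complex) = of_rat (of_int k)" for k by simp
  show ?thesis unfolding * i nu_comb el_eq_iff of_int_add of_int_diff of_int_mult of_int_power of_int_numeral of_int_minus
    by (intro conjI; Groebner_Basis.algebra)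
qed

lemma nu_v: "32 * v = of_int (3*z^11 - 26*z^9 + 92*z^7 - 160*z^5 + 96*z^3)
  + of_int (20*z^8 - 136*z^6 + 416*z^4 - 640*z^2 + 384) * nu + of_int (16*z^5 - 96*z^3 + 192*z) * nu\<^sup>2 + of_int (- 64*z^2 + 128) * nu ^ 3"
proof -
  have *: "32 * v = el 0 0 0 32" by (simp add: el_def)
  have i: "(of_int k :: complex) = of_rat (of_int k)" for k by simp
  show ?thesis unfolding * i nu_comb el_eq_iff of_int_add of_int_diff of_int_mult of_int_power of_int_numeral of_int_minus
    by (intro conjI; Groebner_Basis.algebra)
qed

section \<open>\<open>L\<close> as a number field of degree four\<close>

lemma subfield_L: "subfield L \<CC>"
  by (rule subfield_CC_I) simp_all

lemma Rats_subset_L: "\<rat> \<subseteq> L"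
  by (auto elim: Rats_cases)

text \<open>Once \<open>nu\<close> lies in the generated field, \<open>nu_d\<close>,
  \<open>nu_w\<close> and \<open>nu_v\<close> put the whole coordinate basis there. Allowing a
  rational translate and a larger \<open>S\<close> covers a single root, its shift by
  \<open>1/2\<close>, and the full set of roots.\<close>

lemma adjoin_eq_L:
  assumes "nu + of_rat q \<in> S" and "S \<subseteq> L"
  shows "adjoin S = L"
proof
  show "adjoin S \<subseteq> L"
    by (rule adjoin_subset[OF subfield_L Rats_subset_L assms(2)])
  have nu: "nu \<in> adjoin S"
    using adjoin_add[OF adjoin_base[OF assms(1)] adjoin_of_rat[of "- q"]] by (simp add: of_rat_minus)
  have i: "of_int n \<in> adjoin S" for n using adjoin_of_rat[of "of_int n"] by simp
  have p: "of_int a + of_int b * nu + of_int c * nu\<^sup>2 + of_int e * nu ^ 3 \<in> adjoin S" for a b c e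
    using nu i by (auto intro!: adjoin_add adjoin_mult simp: power2_eq_square power3_eq_cube)
  have h: "x \<in> adjoin S" if "32 * x \<in> adjoin S" for x
    using adjoin_mult[OF adjoin_of_rat[of "1/32"] that] by (simp add: of_rat_divide)
  have "d \<in> adjoin S" "w \<in> adjoin S" "v \<in> adjoin S"
    by (rule h, unfold nu_d nu_w nu_v, rule p)+
  then show "L \<subseteq> adjoin S"
    by (auto simp: L_def el_def intro!: adjoin_add adjoin_mult)
qed

text \<open>\<open>L\<close> is built from \<open>{0}\<close> by adding the lines through
  \<open>v\<close>, \<open>w\<close>, \<open>d\<close>, \<open>1\<close> in turn; uniqueness of
  coordinates shows each of them to be new.\<close>

lemma dimension_L: "CC.dimension 4 \<rat> L"
proof -
  have le: "x \<in> CC.line_extension \<rat> a E \<longleftrightarrow> (\<exists>k. \<exists>y\<in>E. x = of_rat k * a + y)" for a E x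
    unfolding CC.line_extension_mem_iff Rats_def by simp
  have 1: "CC.line_extension \<rat> v {0} = {el 0 0 0 u |u. True}"
    by (rule Set.set_eqI) (simp add: le el_def)
  have e: "of_rat k * w + el 0 0 0 u = el 0 0 k u"
    "of_rat k * d + el 0 0 t u = el 0 k t u" "of_rat k * 1 + el 0 s t u = el k s t u" for k s t u
    by (simp_all add: el_def)
  have ex: "(\<exists>y\<in>{f u |u. True}. P y) \<longleftrightarrow> (\<exists>u. P (f u))"
    "(\<exists>y\<in>{g t u |t u. True}. P y) \<longleftrightarrow> (\<exists>t u. P (g t u))"
    "(\<exists>y\<in>{h s t u |s t u. True}. P y) \<longleftrightarrow> (\<exists>s t u. P (h s t u))"
    for f :: "rat \<Rightarrow> complex" and g :: "rat \<Rightarrow> rat \<Rightarrow> complex" and h :: "rat \<Rightarrow> rat \<Rightarrow> rat \<Rightarrow> complex" and P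
    by blast+
  have 2: "CC.line_extension \<rat> w {el 0 0 0 u |u. True} = {el 0 0 t u |t u. True}"
    by (rule Set.set_eqI) (unfold le ex e mem_Collect_eq, simp)
  have 3: "CC.line_extension \<rat> d {el 0 0 t u |t u. True} = {el 0 s t u |s t u. True}"
    by (rule Set.set_eqI) (unfold le ex e mem_Collect_eq, simp)
  have 4: "CC.line_extension \<rat> 1 {el 0 s t u |s t u. True} = L"
    unfolding L_def by (rule Set.set_eqI) (unfold le ex e mem_Collect_eq, simp)
  have b: "el 0 0 0 1 = v" "el 0 0 1 0 = w" "el 0 1 0 0 = d" "el 1 0 0 0 = 1"
    by (simp_all add: el_def)
  have n: "el 0 0 0 1 \<notin> {0}" "el 0 0 1 0 \<notin> {el 0 0 0 u |u. True}"
    "el 0 1 0 0 \<notin> {el 0 0 t u |t u. True}" "el 1 0 0 0 \<notin> {el 0 s t u |s t u. True}"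
    by (auto simp: el_eq_iff el_eq_0)
  note n = n[unfolded b]
  have "CC.dimension 0 \<rat> {0}" using CC.zero_dim by simp
  from CC.Suc_dim[OF _ n(1) this, unfolded 1]
  have "CC.dimension (Suc 0) \<rat> {el 0 0 0 u |u. True}" by simp
  from CC.Suc_dim[OF _ n(2) this, unfolded 2]
  have "CC.dimension (Suc (Suc 0)) \<rat> {el 0 0 t u |t u. True}" by simp
  from CC.Suc_dim[OF _ n(3) this, unfolded 3]
  have "CC.dimension (Suc (Suc (Suc 0))) \<rat> {el 0 s t u |s t u. True}" by simp
  from CC.Suc_dim[OF _ n(4) this, unfolded 4]
  show ?thesis by (simp add: numeral_eq_Suc)
qed

lemma number_field_L: "number_field L"
  unfolding number_field_def using subfield_L CC.finite_dimensionI[OF dimension_L] by blast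

lemma field_degree_L: "field_degree L = 4"
  unfolding field_degree_def using CC.dimI[OF subfield_Rats dimension_L] by (simp add: over_def)

end

section \<open>The Galois group\<close>

lemma pcompose_depressed_quartic:
  "pcompose [:r, q, p, 0, 1:] [:h, 1:] =
    [:r + q * h + p * h\<^sup>2 + h ^ 4, q + 2 * p * h + 4 * h ^ 3, p + 6 * h\<^sup>2, 4 * h, 1:]"
  for p q r h :: "'a :: comm_ring_1"
  by (simp add: pcompose_pCons algebra_simps power_numeral_reduce)

lemma quartic_conv_depressed:
  "quartic z = pcompose [:depressed_r z, depressed_q z, depressed_p z, 0, 1:] [:- 1/4 * of_int z, 1:]"
  unfolding quartic_def Let_def pcompose_depressed_quartic depressed_p_def depressed_q_def depressed_r_def quartic_D_def quartic_A_def pCons_eq_iff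
  by (intro conjI refl; Groebner_Basis.algebra)

lemma poly_of_rat_pcompose:
  "poly (map_poly of_rat (pcompose p q)) x = poly (map_poly of_rat p) (poly (map_poly of_rat q) (x :: complex))"
  by (simp add: of_rat_hom.map_poly_pcompose poly_pcompose)

lemma poly_quartic:
  "poly (map_poly of_rat (quartic z)) (y + of_rat (1/4 * of_int z)) =
    y ^ 4 + of_rat (depressed_p z) * y\<^sup>2 + of_rat (depressed_q z) * y + (of_rat (depressed_r z) :: complex)"
  unfolding quartic_conv_depressed poly_of_rat_pcompose
  by (simp add: map_poly_pCons of_rat_minus of_rat_divide algebra_simps power_numeral_reduce)

lemma ex_cyclic_quartic: "\<exists>d w. cyclic_quartic z d w"
  by (meson cyclic_quartic.intro power2_csqrt)

text \<open>A root \<open>y\<close> should be \<open>(Z d + w) / 4\<close>, so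
  \<open>4 y - Z d\<close> must have the square prescribed for \<open>w\<close>. This condition on
  \<open>d\<close> is \<open>F d = 0\<close>. The product of the values of \<open>F\<close> at the
  two square roots of \<open>D\<close> is 256 times the depressed quartic at \<open>y\<close>, so
  one sign of \<open>d\<close> works.\<close>

lemma root_imp_cyclic_quartic:
  fixes y :: complex
  assumes "y ^ 4 + of_rat (depressed_p z) * y\<^sup>2 + of_rat (depressed_q z) * y + of_rat (depressed_r z) = 0"
  obtains d w where "cyclic_quartic z d w" and "y = cyclic_quartic.nu z d w"
proof -
  define a Z :: complex where "a = of_rat (quartic_A z)" and "Z = of_int z"
  have a: "a = Z\<^sup>2 - 2" by (simp add: a_def Z_def quartic_A_def of_rat_diff of_rat_power)
  have D: "of_rat (quartic_D z) = a\<^sup>2 + 4" by (simp add: a_def quartic_D_def of_rat_add of_rat_power)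
  have c: "of_rat (depressed_p z) = - 1/8 * ((a\<^sup>2 + 4) * (3 * Z\<^sup>2 - 4))"
    "of_rat (depressed_q z) = - 1/8 * ((a\<^sup>2 + 4) * a\<^sup>2 * Z)"
    "of_rat (depressed_r z) = 1/256 * ((a\<^sup>2 + 4) * (64 - 40 * Z ^ 4 + 20 * Z ^ 6 - 3 * Z ^ 8))"
    unfolding depressed_p_def depressed_q_def depressed_r_def D[symmetric]
    by (simp_all add: a_def Z_def of_rat_mult of_rat_diff of_rat_add of_rat_power of_rat_divide of_rat_minus)
  have *: "\<exists>d. d\<^sup>2 = a\<^sup>2 + 4 \<and> 16 * y\<^sup>2 + Z\<^sup>2 * d\<^sup>2 - 2 * a * d\<^sup>2 - 8 * Z * y * d - 2 * a\<^sup>2 * d = 0"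
  proof -
    obtain d0 where d0: "d0\<^sup>2 = a\<^sup>2 + 4" using power2_csqrt by blast
    define F where "F d = 16 * y\<^sup>2 + Z\<^sup>2 * d\<^sup>2 - 2 * a * d\<^sup>2 - 8 * Z * y * d - 2 * a\<^sup>2 * d" for d
    have "F d0 * F (- d0) = (16 * y\<^sup>2 + Z\<^sup>2 * d0\<^sup>2 - 2 * a * d0\<^sup>2)\<^sup>2 - d0\<^sup>2 * (8 * Z * y + 2 * a\<^sup>2)\<^sup>2"
      unfolding F_def by Groebner_Basis.algebra
    also have "\<dots> = 256 * (y ^ 4 + of_rat (depressed_p z) * y\<^sup>2 + of_rat (depressed_q z) * y + of_rat (depressed_r z))"
      unfolding d0 c a by Groebner_Basis.algebra
    finally have "F d0 = 0 \<or> F (- d0) = 0" using assms by simp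
    then show ?thesis unfolding F_def using d0 by (metis power2_minus)
  qed
  then obtain d where d: "d\<^sup>2 = a\<^sup>2 + 4"
    and F: "16 * y\<^sup>2 + Z\<^sup>2 * d\<^sup>2 - 2 * a * d\<^sup>2 - 8 * Z * y * d - 2 * a\<^sup>2 * d = 0" by blast
  define w where "w = 4 * y - Z * d"
  have "w\<^sup>2 = 16 * y\<^sup>2 + Z\<^sup>2 * d\<^sup>2 - 8 * Z * y * d"
    unfolding w_def by Groebner_Basis.algebra
  also have "\<dots> = 2 * a * d\<^sup>2 + 2 * a\<^sup>2 * d" using F by (simp add: algebra_simps)
  finally have w: "w\<^sup>2 = 2 * a * (a\<^sup>2 + 4 + a * d)" unfolding d by (simp add: algebra_simps power2_eq_square)
  have cq: "cyclic_quartic z d w"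
    by unfold_locales (simp_all add: d w D a_def[symmetric])
  moreover have "y = cyclic_quartic.nu z d w"
    unfolding cyclic_quartic.nu_def[OF cq] cyclic_quartic.el_def[OF cq]
    by (simp add: w_def Z_def of_rat_mult of_rat_divide field_simps)
  ultimately show ?thesis using that by blast
qed

lemma quartic_root_cases:
  fixes x :: complex
  assumes "poly (map_poly of_rat (quartic z)) x = 0"
  obtains d w where "cyclic_quartic z d w" and "x = cyclic_quartic.nu z d w + of_rat (1/4 * of_int z)"
proof -
  define y where "y = x - of_rat (1/4 * of_int z)"
  have "y ^ 4 + of_rat (depressed_p z) * y\<^sup>2 + of_rat (depressed_q z) * y + of_rat (depressed_r z) = 0"
    using assms poly_quartic[of z y] by (simp add: y_def)
  then obtain d w where "cyclic_quartic z d w" "y = cyclic_quartic.nu z d w"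
    by (rule root_imp_cyclic_quartic)
  then show ?thesis using that[of d w] by (simp add: y_def algebra_simps)
qed

context cyclic_quartic
begin

lemma quartic_root: "poly (map_poly of_rat (quartic z)) (nu + of_rat (1/4 * of_int z)) = 0"
  unfolding poly_quartic by (rule nu_4)

lemma irreducible_quartic: "Factorial_Ring.irreducible (quartic z)"
  by (rule irreducible_if_rat_indep_root[OF rat_indep_shift[OF rat_indep_nu] _ quartic_root])
    (simp add: quartic_def Let_def)

lemma nu_eq: "nu = (of_int z * d + w) / 4"
  by (simp add: nu_def el_def of_rat_mult of_rat_divide)

lemma d_in_L [simp]: "d \<in> L" and w_in_L [simp]: "w \<in> L" and v_in_L [simp]: "v \<in> L"
proof -
  have "d = el 0 1 0 0" "w = el 0 0 1 0" "v = el 0 0 0 1" by (simp_all add: el_def)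
  then show "d \<in> L" "w \<in> L" "v \<in> L" by (metis el_in_L)+
qed

text \<open>The four pairs are the images of \<open>(d, w)\<close> under the powers of
  \<open>sg\<close>. Both the normality of \<open>L\<close> and the list of its automorphisms rest
  on this.\<close>

lemma conjugate_cases:
  assumes "d'\<^sup>2 = of_rat D" and "w'\<^sup>2 = 2 * of_rat A * (of_rat D + of_rat A * d')"
  shows "(d' = d \<and> (w' = w \<or> w' = - w)) \<or> (d' = - d \<and> (w' = v \<or> w' = - v))"
proof -
  have "d' = d \<or> d' = - d" using assms(1) d_sq by (simp add: power2_eq_iff[symmetric])
  then show ?thesis
  proof
    assume "d' = d"
    then show ?thesis using assms(2) w_sq by (simp add: power2_eq_iff[symmetric])
  next
    assume "d' = - d"
    then show ?thesis using assms(2) v_sq by (simp add: power2_eq_iff[symmetric])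
  qed
qed

text \<open>Normality: a root comes with its own \<open>d'\<close> and \<open>w'\<close>, which are
  conjugates of \<open>d\<close> and \<open>w\<close> and hence lie in \<open>L\<close>.\<close>

lemma roots_in_L: "{x. poly (map_poly of_rat (quartic z)) x = 0} \<subseteq> L"
proof safe
  fix x :: complex assume "poly (map_poly of_rat (quartic z)) x = 0"
  then obtain d' w' where cq: "cyclic_quartic z d' w'"
    and x: "x = cyclic_quartic.nu z d' w' + of_rat (1/4 * of_int z)"
    by (rule quartic_root_cases)
  have "d' \<in> L \<and> w' \<in> L"
    using conjugate_cases[OF cyclic_quartic.d_sq[OF cq] cyclic_quartic.w_sq[OF cq]] by auto
  then have "of_rat (1/4) * (of_int z * d' + w') + of_rat (1/4 * of_int z) \<in> L"
    by (intro L_add L_mult L_of_rat) simp_all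
  also have "of_rat (1/4) * (of_int z * d' + w') + of_rat (1/4 * of_int z) = x"
    unfolding x cyclic_quartic.nu_eq[OF cq] by (simp add: of_rat_divide of_rat_mult)
  finally show "x \<in> L" .
qed

lemma splitting_field_quartic: "splitting_field (quartic z) = L"
  unfolding splitting_field_def
  by (rule adjoin_eq_L[of "1/4 * of_int z"]) (use quartic_root roots_in_L in auto)

text \<open>Restriction to \<open>L\<close> makes the powers of \<open>sg\<close> extensional, as
  the carrier of the Galois group demands.\<close>

definition gal :: "nat \<Rightarrow> complex \<Rightarrow> complex"
  where "gal i = restrict (sg ^^ i) L"

lemma sg_pow_in_L [simp]: "x \<in> L \<Longrightarrow> (sg ^^ i) x \<in> L"
  by (induction i) simp_all

lemma sg_pow_add: "x \<in> L \<Longrightarrow> y \<in> L \<Longrightarrow> (sg ^^ i) (x + y) = (sg ^^ i) x + (sg ^^ i) y"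
  by (induction i) (simp_all add: sg_add)

lemma sg_pow_mult: "x \<in> L \<Longrightarrow> y \<in> L \<Longrightarrow> (sg ^^ i) (x * y) = (sg ^^ i) x * (sg ^^ i) y"
  by (induction i) (simp_all add: sg_mult)

lemma sg_pow_of_rat [simp]: "(sg ^^ i) (of_rat q) = of_rat q"
  by (induction i) simp_all

lemma sg_pow_mod_4: "x \<in> L \<Longrightarrow> (sg ^^ i) x = (sg ^^ (i mod 4)) x"
proof (induction i rule: less_induct)
  case (less i)
  show ?case
  proof (cases "i < 4")
    case False
    then obtain j where j: "i = j + 4" by (metis add.commute le_Suc_ex not_less)
    have "(sg ^^ i) x = (sg ^^ j) ((sg ^^ 4) x)" unfolding j by (simp only: funpow_add o_apply)
    also have "(sg ^^ 4) x = x" using less.prems by (simp add: numeral_eq_Suc)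
    finally show ?thesis using less.IH[of j] less.prems j by simp
  qed simp
qed

lemma gal_mod_4: "gal (i mod 4) = gal i"
  unfolding gal_def by (rule restrict_ext) (simp add: sg_pow_mod_4[symmetric])

lemma gal_compose: "compose L (gal i) (gal j) = gal (i + j)"
  unfolding gal_def compose_def by (rule restrict_ext) (simp add: funpow_add)

lemma gal_Bij: "gal i \<in> Bij L"
proof -
  have "bij_betw (sg ^^ i) L L"
  \<comment> \<open>The fourth power of \<open>sg\<close> is the identity on \<open>L\<close>, so
    \<open>sg ^^ (3 * i)\<close> inverts \<open>sg ^^ i\<close>.\<close>
  proof (rule bij_betwI[where g = "sg ^^ (3 * i)"])
    have e: "(sg ^^ (4 * i)) x = x" if "x \<in> L" for x
      using sg_pow_mod_4[OF that, of "4 * i"] by simp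
    show "(sg ^^ (3 * i)) ((sg ^^ i) x) = x" if "x \<in> L" for x
      using e[OF that] by (simp add: funpow_add[of "3 * i" i, unfolded fun_eq_iff o_apply, rule_format, symmetric])
    show "(sg ^^ i) ((sg ^^ (3 * i)) x) = x" if "x \<in> L" for x
      using e[OF that] by (simp add: funpow_add[of i "3 * i", unfolded fun_eq_iff o_apply, rule_format, symmetric])
  qed auto
  then show ?thesis by (simp add: Bij_def gal_def bij_betw_restrict_eq)
qed

abbreviation G where "G \<equiv> galois_group (quartic z)"

lemma mult_G: "\<sigma> \<in> Bij L \<Longrightarrow> \<tau> \<in> Bij L \<Longrightarrow> \<sigma> \<otimes>\<^bsub>G\<^esub> \<tau> = compose L \<sigma> \<tau>"
  and one_G: "\<one>\<^bsub>G\<^esub> = gal 0"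
  by (simp_all add: galois_group_def Let_def splitting_field_quartic BijGroup_def gal_def id_def)

text \<open>An automorphism is determined by the images of \<open>d\<close> and \<open>w\<close>,
  since \<open>v\<close> is a polynomial in them; their defining equations leave only the four pairs
  of \<open>conjugate_cases\<close>.\<close>

lemma carrier_G: "carrier G = range gal"
proof
  have "gal i \<in> carrier G" for i
  proof -
    have "gal i \<in> Ring.ring_hom (\<CC>\<lparr>carrier := L\<rparr>) (\<CC>\<lparr>carrier := L\<rparr>)"
      using sg_pow_of_rat[of i 1]
      by (intro ring_hom_memI) (simp_all add: gal_def sg_pow_add sg_pow_mult)
    moreover have "\<forall>q\<in>\<rat>. gal i q = q" by (auto simp: gal_def elim!: Rats_cases)
    ultimately show ?thesis
      by (simp add: galois_group_def Let_def splitting_field_quartic gal_Bij)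
  qed
  then show "range gal \<subseteq> carrier G" by blast
  show "carrier G \<subseteq> range gal"
  proof
    fix \<sigma> assume "\<sigma> \<in> carrier G"
    then have bij: "\<sigma> \<in> Bij L" and hom: "\<sigma> \<in> Ring.ring_hom (\<CC>\<lparr>carrier := L\<rparr>) (\<CC>\<lparr>carrier := L\<rparr>)"
      and fix_Rats: "\<And>q. \<sigma> (of_rat q) = of_rat q"
      by (simp_all add: galois_group_def Let_def splitting_field_quartic)
    have mult: "\<sigma> (x * y) = \<sigma> x * \<sigma> y" and add: "\<sigma> (x + y) = \<sigma> x + \<sigma> y"
      if "x \<in> L" "y \<in> L" for x y
      using ring_hom_mult[OF hom] ring_hom_add[OF hom] that by simp_all
    define d' w' where "d' = \<sigma> d" and "w' = \<sigma> w"
    have "d'\<^sup>2 = \<sigma> (d\<^sup>2)" by (simp add: power2_eq_square mult d'_def)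
    then have d': "d'\<^sup>2 = of_rat D" by (simp add: d_sq fix_Rats)
    have "w'\<^sup>2 = \<sigma> (w\<^sup>2)" by (simp add: power2_eq_square mult w'_def)
    also have "w\<^sup>2 = of_rat (2 * A * D) + of_rat (2 * A\<^sup>2) * d"
      unfolding w_sq by (simp add: of_rat_mult of_rat_power algebra_simps power2_eq_square)
    also have "\<sigma> \<dots> = of_rat (2 * A * D) + of_rat (2 * A\<^sup>2) * d'"
      by (simp add: add mult fix_Rats d'_def)
    finally have w': "w'\<^sup>2 = 2 * of_rat A * (of_rat D + of_rat A * d')"
      by (simp add: of_rat_mult of_rat_power algebra_simps power2_eq_square)
    have "v = of_rat (1/2) * (d * w) + of_rat (- A / 2) * w"
      by (simp add: v_def of_rat_divide of_rat_minus field_simps)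
    then have "\<sigma> v = of_rat (1/2) * (d' * w') + of_rat (- A / 2) * w'"
      by (simp add: add mult fix_Rats d'_def w'_def)
    then have v': "\<sigma> v = (d' * w' - of_rat A * w') / 2"
      by (simp add: of_rat_divide of_rat_minus field_simps)
    have img: "\<sigma> (el r s t u) = of_rat r + of_rat s * d' + of_rat t * w' + of_rat u * \<sigma> v" for r s t u
      by (simp add: el_def add mult fix_Rats d'_def w'_def)
    have eqI: "\<sigma> = gal i" if "\<And>r s t u. \<sigma> (el r s t u) = (sg ^^ i) (el r s t u)" for i
    proof (rule extensionalityI[of _ L])
      show "\<sigma> \<in> extensional L" using bij by (rule Bij_imp_extensional)
      show "gal i \<in> extensional L" by (simp add: gal_def)
      show "\<sigma> x = gal i x" if "x \<in> L" for x
        using that \<open>\<And>r s t u. \<sigma> (el r s t u) = (sg ^^ i) (el r s t u)\<close> by (auto simp: gal_def elim!: L_cases)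
    qed
    from conjugate_cases[OF d' w']
    \<comment> \<open>Listed in the order of the powers 0, 1, 2, 3 of \<open>sg\<close>.\<close>
    consider "d' = d" "w' = w" | "d' = - d" "w' = v" | "d' = d" "w' = - w" | "d' = - d" "w' = - v"
      by blast
    then show "\<sigma> \<in> range gal"
    proof cases
      case 1
      then have "\<sigma> v = v" using v' d_w by simp
      then have "\<sigma> = gal 0" by (intro eqI) (simp add: img 1, simp add: el_def)
      then show ?thesis by blast
    next
      case 2
      then have "\<sigma> v = - w" using v' d_v by simp
      then have "\<sigma> = gal 1" by (intro eqI) (simp add: img 2, simp add: el_def of_rat_minus)
      then show ?thesis by blast
    next
      case 3
      then have "\<sigma> v = - v" using v' d_w by simp
      then have "\<sigma> = gal 2" by (intro eqI) (simp add: img 3 numeral_2_eq_2, simp add: el_def of_rat_minus)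
      then show ?thesis by blast
    next
      case 4
      then have "\<sigma> v = w" using v' d_v by simp
      then have "\<sigma> = gal 3" by (intro eqI) (simp add: img 4 numeral_3_eq_3, simp add: el_def of_rat_minus)
      then show ?thesis by blast
    qed
  qed
qed

lemma gal_mult: "gal i \<otimes>\<^bsub>G\<^esub> gal j = gal (i + j)"
  by (simp add: mult_G gal_Bij gal_compose)

lemma group_G: "group G"
proof (rule groupI)
  show "\<exists>y\<in>carrier G. y \<otimes>\<^bsub>G\<^esub> x = \<one>\<^bsub>G\<^esub>" if "x \<in> carrier G" for x
  proof -
    obtain i where i: "x = gal i" using \<open>x \<in> carrier G\<close> carrier_G by blast
    have "gal (3 * i) \<otimes>\<^bsub>G\<^esub> gal i = gal 0"
      using gal_mod_4[of "4 * i"] by (simp add: gal_mult)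
    then show ?thesis using i carrier_G one_G by auto
  qed
qed (auto simp: carrier_G one_G gal_mult add_ac)

lemma cyclic_group_G: "cyclic_group G"
proof -
  interpret G: group G by (rule group_G)
  have pow: "gal 1 [^]\<^bsub>G\<^esub> i = gal i" for i :: nat
    by (induction i) (simp_all add: one_G gal_mult)
  have "gal 1 \<in> carrier G" by (simp add: carrier_G)
  moreover have "carrier G = range (\<lambda>n::int. gal 1 [^]\<^bsub>G\<^esub> n)"
  proof
    have "gal i = gal 1 [^]\<^bsub>G\<^esub> int i" for i by (simp only: int_pow_int pow)
    then show "carrier G \<subseteq> range (\<lambda>n::int. gal 1 [^]\<^bsub>G\<^esub> n)"
      unfolding carrier_G by blast
    show "range (\<lambda>n::int. gal 1 [^]\<^bsub>G\<^esub> n) \<subseteq> carrier G"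
      using \<open>gal 1 \<in> carrier G\<close> by auto
  qed
  ultimately show ?thesis unfolding G.cyclic_group by blast
qed

lemma order_G: "Coset.order G = 4"
proof -
  have "range gal = gal ` {0..<4}"
  proof -
    have "gal i \<in> gal ` {0..<4}" for i
      using imageI[of "i mod 4" "{0..<4}" gal] by (simp add: gal_mod_4)
    then show ?thesis by blast
  qed
  moreover have "inj_on gal {0..<4}"
  proof (rule inj_onI)
    fix i j :: nat
    assume ij: "i \<in> {0..<4}" "j \<in> {0..<4}" and eq: "gal i = gal j"
    \<comment> \<open>The element \<open>w\<close> has the four distinct images \<open>w\<close>,
      \<open>v\<close>, \<open>-w\<close>, \<open>-v\<close>, so it separates the powers of
      \<open>sg\<close>.\<close>
    from fun_cong[OF eq, of "el 0 0 1 0"]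
    have "(sg ^^ i) (el 0 0 1 0) = (sg ^^ j) (el 0 0 1 0)" by (simp add: gal_def)
    moreover have "i = 0 \<or> i = Suc 0 \<or> i = Suc (Suc 0) \<or> i = Suc (Suc (Suc 0))"
      "j = 0 \<or> j = Suc 0 \<or> j = Suc (Suc 0) \<or> j = Suc (Suc (Suc 0))" using ij by auto
    ultimately show "i = j" by (auto simp: el_eq_iff)
  qed
  ultimately show ?thesis
    by (simp add: Coset.order_def carrier_G card_image)
qed

end

section \<open>Denominators of algebraic integers\<close>

definition power_lattice :: "complex \<Rightarrow> complex set"
  where "power_lattice x = {of_int a + of_int b * x + of_int c * x\<^sup>2 + of_int e * x ^ 3 |a b c e. True}"

lemma power_lattice_I: "of_int a + of_int b * x + of_int c * x\<^sup>2 + of_int e * x ^ 3 \<in> power_lattice x"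
  by (auto simp: power_lattice_def)

lemma power_lattice_cases:
  assumes "y \<in> power_lattice x"
  obtains a b c e where "y = of_int a + of_int b * x + of_int c * x\<^sup>2 + of_int e * x ^ 3"
  using assms by (auto simp: power_lattice_def)

lemma power_lattice_add:
  assumes "y \<in> power_lattice x" and "y' \<in> power_lattice x"
  shows "y + y' \<in> power_lattice x"
proof -
  obtain a b c e where y: "y = of_int a + of_int b * x + of_int c * x\<^sup>2 + of_int e * x ^ 3"
    using assms(1) by (rule power_lattice_cases)
  obtain a' b' c' e' where y': "y' = of_int a' + of_int b' * x + of_int c' * x\<^sup>2 + of_int e' * x ^ 3"
    using assms(2) by (rule power_lattice_cases)
  have "y + y' = of_int (a + a') + of_int (b + b') * x + of_int (c + c') * x\<^sup>2 + of_int (e + e') * x ^ 3"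
    unfolding y y' of_int_add by Groebner_Basis.algebra
  then show ?thesis by (metis power_lattice_I)
qed

lemma power_lattice_scale:
  assumes "y \<in> power_lattice x"
  shows "of_int k * y \<in> power_lattice x"
proof -
  obtain a b c e where y: "y = of_int a + of_int b * x + of_int c * x\<^sup>2 + of_int e * x ^ 3"
    using assms(1) by (rule power_lattice_cases)
  have "of_int k * y = of_int (k * a) + of_int (k * b) * x + of_int (k * c) * x\<^sup>2 + of_int (k * e) * x ^ 3"
    unfolding y of_int_mult by Groebner_Basis.algebra
  then show ?thesis by (metis power_lattice_I)
qed

lemma power_lattice_1: "1 \<in> power_lattice x"
  using power_lattice_I[of 1 0 x 0 0] by simp

text \<open>Expanding an integer translate gives integer coefficients again; the reverse inclusion
  is the translate by \<open>- n\<close>.\<close>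

lemma power_lattice_shift: "power_lattice (x + of_int n) = power_lattice x"
proof -
  have sub: "power_lattice (x + of_int n) \<subseteq> power_lattice x" for x n
  proof
    fix y assume "y \<in> power_lattice (x + of_int n)"
    then obtain a b c e where y: "y = of_int a + of_int b * (x + of_int n)
        + of_int c * (x + of_int n)\<^sup>2 + of_int e * (x + of_int n) ^ 3" by (rule power_lattice_cases)
    have "y = of_int (a + b * n + c * n\<^sup>2 + e * n ^ 3) + of_int (b + 2 * c * n + 3 * e * n\<^sup>2) * x
      + of_int (c + 3 * e * n) * x\<^sup>2 + of_int e * x ^ 3"
      unfolding y of_int_add of_int_mult of_int_power of_int_numeral by Groebner_Basis.algebra
    then show "y \<in> power_lattice x" by (metis power_lattice_I)
  qed
  have "power_lattice x \<subseteq> power_lattice (x + of_int n)" using sub[of "x + of_int n" "- n"] by simp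
  then show ?thesis using sub[of x n] by blast
qed

text \<open>Substituting \<open>x' - n/4\<close> into a cubic produces denominators up to
  \<open>4 ^ 3 = 64\<close>. A power of 2 is harmless once the lattice is known to be maximal at
  2.\<close>

lemma power_lattice_quarter_shift:
  assumes "y \<in> power_lattice x"
  shows "64 * y \<in> power_lattice (x + of_int n / 4)"
proof -
  obtain a b c e where y: "y = of_int a + of_int b * x + of_int c * x\<^sup>2 + of_int e * x ^ 3"
    using assms(1) by (rule power_lattice_cases)
  define m :: complex where "m = of_int n / 4"
  define x' where "x' = x + m"
  have x: "x = x' - m" and n: "of_int n = 4 * m" by (simp_all add: x'_def m_def)
  have "64 * y = of_int (64 * a - 16 * b * n + 4 * c * n\<^sup>2 - e * n ^ 3)
    + of_int (64 * b - 32 * c * n + 12 * e * n\<^sup>2) * x' + of_int (64 * c - 48 * e * n) * x'\<^sup>2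
    + of_int (64 * e) * x' ^ 3"
    unfolding y x of_int_add of_int_diff of_int_mult of_int_power of_int_numeral n
    by Groebner_Basis.algebra
  then have "64 * y \<in> power_lattice x'" by (metis power_lattice_I)
  then show ?thesis by (simp only: x'_def m_def)
qed

lemma rat_indep_int:
  assumes "rat_indep x"
    and "of_int a + of_int b * x + of_int c * x\<^sup>2 + of_int e * x ^ 3 = 0"
  shows "a = 0 \<and> b = 0 \<and> c = 0 \<and> e = 0"
proof -
  have "of_rat (of_int a) + of_rat (of_int b) * x + of_rat (of_int c) * x\<^sup>2 + of_rat (of_int e) * x ^ 3 = 0"
    using assms(2) by simp
  then have "of_int a = (0 :: rat) \<and> of_int b = (0 :: rat) \<and> of_int c = (0 :: rat) \<and> of_int e = (0 :: rat)"
    using assms(1) unfolding rat_indep_def by blast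
  then show ?thesis by simp
qed

lemma int_basis_power_lattice:
  assumes "rat_indep x"
  shows "int_basis [1, x, x\<^sup>2, x ^ 3] (power_lattice x)"
proof -
  note ind = rat_indep_int[OF assms]
  \<comment> \<open>Any coincidence between two of the powers would be an integer relation.\<close>
  have "1 \<noteq> x" "1 \<noteq> x\<^sup>2" using ind[of 1 "- 1" 0 0] ind[of 1 0 "- 1" 0] by auto
  moreover have "1 \<noteq> x ^ 3" "x \<noteq> x\<^sup>2" using ind[of 1 0 0 "- 1"] ind[of 0 1 "- 1" 0] by auto
  moreover have "x \<noteq> x ^ 3" "x\<^sup>2 \<noteq> x ^ 3" using ind[of 0 1 0 "- 1"] ind[of 0 0 1 "- 1"] by auto
  ultimately have ne: "1 \<noteq> x" "1 \<noteq> x\<^sup>2" "1 \<noteq> x ^ 3" "x \<noteq> x\<^sup>2" "x \<noteq> x ^ 3" "x\<^sup>2 \<noteq> x ^ 3"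
    by blast+
  let ?S = "{1, x, x\<^sup>2, x ^ 3}"
  have fin: "finite ?S" by simp
  have sum: "(\<Sum>y\<in>?S. of_int (u y) * y) =
    of_int (u 1) + of_int (u x) * x + of_int (u (x\<^sup>2)) * x\<^sup>2 + of_int (u (x ^ 3)) * x ^ 3" for u
    using ne by (simp add: add.assoc)
  have "\<not> int_mod.dependent ?S"
    unfolding int_mod.dependent_finite[OF fin] sum
  proof (rule notI, elim exE conjE)
    fix u :: "complex \<Rightarrow> int"
    assume "\<exists>y\<in>?S. u y \<noteq> 0"
      and "of_int (u 1) + of_int (u x) * x + of_int (u (x\<^sup>2)) * x\<^sup>2 + of_int (u (x ^ 3)) * x ^ 3 = 0"
    then show False using ind by blast
  qed
  moreover have "int_mod.span ?S = power_lattice x"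
  proof
    show "int_mod.span ?S \<subseteq> power_lattice x"
      unfolding int_mod.span_finite[OF fin] sum by (auto simp: power_lattice_I)
    have "of_int a * 1 + of_int b * x + of_int c * x\<^sup>2 + of_int e * x ^ 3 \<in> int_mod.span ?S" for a b c e
      by (intro int_mod.span_add int_mod.span_scale int_mod.span_base) auto
    then show "power_lattice x \<subseteq> int_mod.span ?S" by (auto simp: power_lattice_def)
  qed
  ultimately show ?thesis using ne by (simp add: int_basis_def)
qed

lemma algebraic_int_quartic:
  fixes x :: complex
  assumes "x ^ 4 + of_int c3 * x ^ 3 + of_int c2 * x\<^sup>2 + of_int c1 * x + of_int c0 = 0"
  shows "algebraic_int x"
proof -
  have "poly (map_poly of_int [:c0, c1, c2, c3, 1:]) x = 0"
    using assms by (simp add: map_poly_pCons algebra_simps power_numeral_reduce)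
  then show ?thesis
    unfolding algebraic_int_altdef_ipoly by (intro exI[of _ "[:c0, c1, c2, c3, 1:]"]) simp
qed

lemma algebraic_int_power_lattice:
  assumes "algebraic_int x" and "y \<in> power_lattice x"
  shows "algebraic_int y"
  using assms by (auto elim!: power_lattice_cases intro!: algebraic_int_add algebraic_int_mult algebraic_int_pow)

section \<open>Consequences of the squarefree conditions\<close>

lemma quartic_D_of_int: "quartic_D z = of_int (z ^ 4 - 4 * z\<^sup>2 + 8)"
  unfolding quartic_D_def quartic_A_def of_int_add of_int_diff of_int_mult of_int_power of_int_numeral
  by Groebner_Basis.algebra

lemma quartic_A_of_int: "quartic_A z = of_int (z\<^sup>2 - 2)"
  by (simp add: quartic_A_def)

text \<open>For even \<open>z\<close>, \<open>D\<close> is 4 times a squarefree number, and the 4 is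
  absorbed into \<open>(2 * x)\<^sup>2\<close>; this costs the factor 2 in the conclusion.\<close>

lemma square_quartic_D_Ints:
  assumes "squarefree_conditions z" and "quartic_D z * x\<^sup>2 \<in> \<int>"
  shows "2 * x \<in> \<int>"
proof (cases "even z")
  case True
  then obtain y where y: "z = 2 * y" by (rule evenE)
  have D: "z ^ 4 - 4 * z\<^sup>2 + 8 = 4 * (4 * y ^ 4 - 4 * y\<^sup>2 + 2)" by (simp add: y power_mult_distrib)
  have "squarefree (4 * y ^ 4 - 4 * y\<^sup>2 + 2)"
    using assms(1) True unfolding squarefree_conditions_def D by simp
  moreover have "of_int (4 * y ^ 4 - 4 * y\<^sup>2 + 2) * (2 * x)\<^sup>2 = quartic_D z * x\<^sup>2"
    unfolding quartic_D_of_int D by (simp add: power_mult_distrib algebra_simps)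
  then have "of_int (4 * y ^ 4 - 4 * y\<^sup>2 + 2) * (2 * x)\<^sup>2 \<in> \<int>" using assms(2) by metis
  ultimately show ?thesis by (rule squarefree_mult_square_Ints)
next
  case False
  then have "squarefree (z ^ 4 - 4 * z\<^sup>2 + 8)" using assms(1) by (simp add: squarefree_conditions_def)
  then have "x \<in> \<int>" by (rule squarefree_mult_square_Ints) (use assms(2) quartic_D_of_int in simp)
  then show ?thesis by simp
qed

text \<open>Since \<open>D - A\<^sup>2 = 4\<close>, \<open>A\<close> and \<open>D\<close> are
  coprime away from 2, so their squarefree parts multiply to a squarefree number. For even
  \<open>z\<close> one has \<open>A * D = 16 * a * m\<close>, and the 16 goes into
  \<open>(4 * x)\<^sup>2\<close>.\<close>

lemma square_quartic_A_quartic_D_Ints: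
  assumes "squarefree_conditions z" and "quartic_A z * quartic_D z * x\<^sup>2 \<in> \<int>"
  shows "4 * x \<in> \<int>"
proof (cases "even z")
  case True
  then obtain y where y: "z = 2 * y" by (rule evenE)
  define a m where "a = 2 * y\<^sup>2 - 1" and "m = 2 * y ^ 4 - 2 * y\<^sup>2 + 1"
  have A: "z\<^sup>2 - 2 = 2 * a" by (simp add: y a_def power_mult_distrib)
  have D: "z ^ 4 - 4 * z\<^sup>2 + 8 = 4 * (2 * m)" by (simp add: y m_def power_mult_distrib)
  have "squarefree (2 * a)" "squarefree (2 * m)"
    using assms(1) True unfolding squarefree_conditions_def A D by simp_all
  moreover have "coprime a m"
  proof (rule coprimeI)
    fix c assume "c dvd a" "c dvd m"
    then have "c dvd 2 * m - a * a" "c dvd a" by auto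
    moreover have "2 * m - a * a = 1"
      unfolding a_def m_def by Groebner_Basis.algebra
    ultimately show "c dvd 1" by simp
  qed
  ultimately have "squarefree (a * m)"
    using squarefree_multD by (intro squarefree_mult_coprime) blast+
  moreover have "of_int (a * m) * (4 * x)\<^sup>2 = quartic_A z * quartic_D z * x\<^sup>2"
    unfolding quartic_A_of_int quartic_D_of_int A D by (simp add: power_mult_distrib algebra_simps)
  then have "of_int (a * m) * (4 * x)\<^sup>2 \<in> \<int>" using assms(2) by metis
  ultimately show ?thesis by (rule squarefree_mult_square_Ints)
next
  case False
  have "coprime (z\<^sup>2 - 2) (z ^ 4 - 4 * z\<^sup>2 + 8)"
  proof (rule coprimeI)
    fix c assume c: "c dvd z\<^sup>2 - 2" "c dvd z ^ 4 - 4 * z\<^sup>2 + 8"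
    have "c dvd (z ^ 4 - 4 * z\<^sup>2 + 8) - (z\<^sup>2 - 2) * (z\<^sup>2 - 2)"
      by (rule dvd_diff[OF c(2) dvd_mult[OF c(1)]])
    moreover have "(z ^ 4 - 4 * z\<^sup>2 + 8) - (z\<^sup>2 - 2) * (z\<^sup>2 - 2) = 2 ^ 2"
      by Groebner_Basis.algebra
    ultimately have "c dvd 2 ^ 2" by simp
    moreover have "odd (z\<^sup>2 - 2)" using False by simp
    then have "odd c" using c(1) dvd_trans by blast
    then have "coprime c (2 ^ 2)"
      by (simp only: coprime_power_right_iff coprime_right_2_iff_odd) simp
    ultimately show "c dvd 1" by (metis coprime_common_divisor dvd_refl)
  qed
  then have "squarefree ((z\<^sup>2 - 2) * (z ^ 4 - 4 * z\<^sup>2 + 8))"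
    using assms(1) False by (intro squarefree_mult_coprime) (simp_all add: squarefree_conditions_def)
  then have "x \<in> \<int>"
    by (rule squarefree_mult_square_Ints) (use assms(2) in \<open>simp add: quartic_A_of_int quartic_D_of_int\<close>)
  then show ?thesis by simp
qed

section \<open>Bounding the denominators of the coordinates\<close>

context cyclic_quartic
begin

lemma tr_Ints:
  assumes "algebraic_int (el r s t u)"
  shows "4 * r \<in> \<int>"
  using algebraic_int_tr[OF _ assms] by (auto simp: tr_el intro: algebraic_int_of_rat)

text \<open>Trace and norm of the quadratic subfield, on which \<open>sg\<close> acts as
  conjugation.\<close>

lemma quadratic_trace_norm_Ints:
  assumes "algebraic_int (el a b 0 0)"
  shows "2 * a \<in> \<int>" and "a\<^sup>2 - D * b\<^sup>2 \<in> \<int>"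
proof -
  have sg: "algebraic_int (sg (el a b 0 0))" by (rule algebraic_int_sg[OF el_in_L assms])
  have "el a b 0 0 + sg (el a b 0 0) = of_rat (2 * a)"
    by (simp add: el_add el_of_rat)
  then show "2 * a \<in> \<int>" using algebraic_int_add[OF assms sg] algebraic_int_of_rat by metis
  have "el a b 0 0 * sg (el a b 0 0) = of_rat (a\<^sup>2 - D * b\<^sup>2)"
    by (simp add: el_mult el_of_rat power2_eq_square mult_ac)
  then show "a\<^sup>2 - D * b\<^sup>2 \<in> \<int>" using algebraic_int_mult[OF assms sg] algebraic_int_of_rat by metis
qed

lemma A_Ints: "A \<in> \<int>"
  by (simp add: quartic_A_def)

text \<open>Adding or subtracting the image under the square of \<open>sg\<close> separates
  \<open>r, s\<close> from \<open>t, u\<close>. The first part is a quadratic integer, so its trace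
  and norm bound \<open>s\<close>. The second part has its square in the quadratic subfield, where
  the same argument can be repeated.\<close>

lemma algebraic_int_coordinates:
  assumes sf: "squarefree_conditions z" and "algebraic_int (el r s t u)"
  shows "4 * r \<in> \<int>" and "8 * s \<in> \<int>" and "32 * t \<in> \<int>" and "32 * u \<in> \<int>"
proof -
  define P Q where "P = 2 * t" and "Q = 2 * u"
  have cj: "algebraic_int (sg (sg (el r s t u)))"
    using assms(2) algebraic_int_sg el_in_L sg_in_L by blast
  have "el r s t u + sg (sg (el r s t u)) = el (2 * r) (2 * s) 0 0"
    by (simp add: el_add)
  then have 1: "algebraic_int (el (2 * r) (2 * s) 0 0)"
    using algebraic_int_add[OF assms(2) cj] by simp
  have "el r s t u - sg (sg (el r s t u)) = el 0 0 P Q"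
    by (simp add: el_diff P_def Q_def)
  then have 2: "algebraic_int (el 0 0 P Q)"
    using algebraic_int_diff[OF assms(2) cj] by simp
  show r: "4 * r \<in> \<int>" using assms(2) by (rule tr_Ints)
  have "D * (4 * s)\<^sup>2 = (4 * r)\<^sup>2 - 4 * ((2 * r)\<^sup>2 - D * (2 * s)\<^sup>2)"
    by (simp add: power_mult_distrib)
  also have "\<dots> \<in> \<int>"
    by (rule Ints_diff[OF Ints_power[OF r] Ints_mult[OF Ints_numeral quadratic_trace_norm_Ints(2)[OF 1]]])
  finally have "2 * (4 * s) \<in> \<int>" by (rule square_quartic_D_Ints[OF sf])
  then show "8 * s \<in> \<int>" by simp
  \<comment> \<open>\<open>n + h d\<close> is the square of \<open>P w + Q v\<close>, and its norm
    is \<open>D * k\<^sup>2\<close>; so both \<open>h\<close> and \<open>k\<close> have bounded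
    denominators.\<close>
  define n h k where "n = 2 * A * D * (P\<^sup>2 + Q\<^sup>2)" and "h = 2 * A\<^sup>2 * (P\<^sup>2 - Q\<^sup>2) + 8 * A * P * Q"
    and "k = 4 * A * (P\<^sup>2 - Q\<^sup>2) - 4 * A\<^sup>2 * P * Q"
  have "(el 0 0 P Q)\<^sup>2 = el n h 0 0"
    by (simp add: power2_eq_square el_mult n_def h_def mult_ac)
  then have 3: "algebraic_int (el n h 0 0)" using algebraic_int_pow[OF 2, of 2] by simp
  note nh = quadratic_trace_norm_Ints[OF 3]
  have "D * (2 * h)\<^sup>2 = (2 * n)\<^sup>2 - 4 * (n\<^sup>2 - D * h\<^sup>2)" by (simp add: power_mult_distrib)
  also have "\<dots> \<in> \<int>" 
    by (rule Ints_diff[OF Ints_power[OF nh(1)] Ints_mult[OF Ints_numeral nh(2)]])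
  finally have "2 * (2 * h) \<in> \<int>" by (rule square_quartic_D_Ints[OF sf])
  then have h: "4 * h \<in> \<int>" by simp
  have "n\<^sup>2 - D * h\<^sup>2 = D * k\<^sup>2"
    unfolding n_def h_def k_def quartic_D_def by Groebner_Basis.algebra
  then have k: "2 * k \<in> \<int>" using nh(2) square_quartic_D_Ints[OF sf, of k] by simp
  \<comment> \<open>Eliminates \<open>P * Q\<close> between \<open>h\<close> and \<open>k\<close>.
    Together with \<open>n\<close>, which carries \<open>P\<^sup>2 + Q\<^sup>2\<close>, this
    isolates \<open>P\<close> and \<open>Q\<close>.\<close>
  have "8 * A * D * (P\<^sup>2 - Q\<^sup>2) = A * (4 * h) + 4 * (2 * k)"
    unfolding h_def k_def quartic_D_def by Groebner_Basis.algebra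
  also have "\<dots> \<in> \<int>" 
    by (rule Ints_add[OF Ints_mult[OF A_Ints h] Ints_mult[OF Ints_numeral k]])
  finally have 4: "8 * A * D * (P\<^sup>2 - Q\<^sup>2) \<in> \<int>" .
  have "A * D * (4 * P)\<^sup>2 = 8 * A * D * (P\<^sup>2 - Q\<^sup>2) + 2 * (2 * n)"
    unfolding n_def by Groebner_Basis.algebra
  also have "\<dots> \<in> \<int>" 
    by (rule Ints_add[OF 4 Ints_mult[OF Ints_numeral nh(1)]])
  finally have "4 * (4 * P) \<in> \<int>" by (rule square_quartic_A_quartic_D_Ints[OF sf])
  then show "32 * t \<in> \<int>" by (simp add: P_def)
  have "A * D * (4 * Q)\<^sup>2 = 2 * (2 * n) - 8 * A * D * (P\<^sup>2 - Q\<^sup>2)"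
    unfolding n_def by Groebner_Basis.algebra
  also have "\<dots> \<in> \<int>" 
    by (rule Ints_diff[OF Ints_mult[OF Ints_numeral nh(1)] 4])
  finally have "4 * (4 * Q) \<in> \<int>" by (rule square_quartic_A_quartic_D_Ints[OF sf])
  then show "32 * u \<in> \<int>" by (simp add: Q_def)
qed

abbreviation OL where "OL \<equiv> ring_of_integers L"

lemma OL_iff: "x \<in> OL \<longleftrightarrow> x \<in> L \<and> algebraic_int x"
  by (simp add: ring_of_integers_def)

text \<open>One factor 32 clears the coordinates, the other expresses \<open>d\<close>,
  \<open>w\<close>, \<open>v\<close> in powers of \<open>nu\<close>.\<close>

lemma two_power_mult_in_power_lattice:
  assumes sf: "squarefree_conditions z" and "x \<in> OL"
  shows "2 ^ 10 * x \<in> power_lattice nu"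
proof -
  obtain r s t u where x: "x = el r s t u" using assms(2) by (auto simp: OL_iff elim: L_cases)
  note co = algebraic_int_coordinates[OF sf, of r s t u]
  have int: "algebraic_int (el r s t u)" using assms(2) by (simp add: OL_iff x)
  obtain a b c e where "4 * r = of_int a" "8 * s = of_int b" "32 * t = of_int c" "32 * u = of_int e"
    using co[OF int] by (metis Ints_cases)
  then have r: "r = of_int a / 4" "s = of_int b / 8" "t = of_int c / 32" "u = of_int e / 32"
    by simp_all
  have "2 ^ 10 * x = of_int (256 * a) * 1 + of_int (4 * b) * (32 * d) + of_int c * (32 * w) + of_int e * (32 * v)"
    by (simp add: x el_def r of_rat_divide)
  also have "\<dots> \<in> power_lattice nu"
    using power_lattice_I nu_d nu_w nu_v by (intro power_lattice_add power_lattice_scale power_lattice_1) metis+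
  finally show ?thesis .
qed

text \<open>The factors 2 are removed one at a time, since each \<open>2 ^ n * x\<close> is again in
  \<open>OL\<close>.\<close>

lemma OL_subset_power_lattice_if_2_maximal:
  assumes "\<And>x. x \<in> OL \<Longrightarrow> 2 * x \<in> power_lattice y \<Longrightarrow> x \<in> power_lattice y"
    and "x \<in> OL" and "2 ^ n * x \<in> power_lattice y"
  shows "x \<in> power_lattice y"
  using assms(3)
proof (induction n)
  case (Suc n)
  have "algebraic_int (2 ^ n * x)"
    using assms(2) algebraic_int_pow[OF algebraic_int_numeral] by (intro algebraic_int_mult) (auto simp: OL_iff)
  moreover have "2 ^ n * x \<in> L"
    using assms(2) L_power[OF L_of_int[of 2], of n] by (auto simp: OL_iff)
  ultimately show ?case
    using Suc assms(1)[of "2 ^ n * x"] by (simp add: OL_iff mult_ac)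
qed simp

lemma tr_add: "x \<in> L \<Longrightarrow> y \<in> L \<Longrightarrow> tr (x + y) = tr x + tr y"
  by (simp add: tr_def sg_add)

lemma tr_of_int_mult: "x \<in> L \<Longrightarrow> tr (of_int k * x) = of_int k * tr x"
  by (simp add: tr_def sg_mult algebra_simps)

lemma tr_comb: "tr (of_rat a + of_rat b * nu + of_rat c * nu\<^sup>2 + of_rat e * nu ^ 3) =
  of_rat (4 * (a + c * (3/16*Z^6 - Z^4 + 5/2*Z^2 - 2) + e * (3/32*Z^9 - 3/4*Z^7 + 21/8*Z^5 - 9/2*Z^3 + 3*Z)))"
  unfolding nu_comb tr_el ..

end

section \<open>Maximality at 2\<close>

context cyclic_quartic
begin

text \<open>The norm is computed in two stages, through the quadratic subfield.\<close>

lemma nm_nu: "nm nu = of_rat (depressed_r z)"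
proof -
  have "nu * sg (sg nu) = el (1/16 * Z\<^sup>2 * D - 1/8 * A * D) (- 1/8 * A\<^sup>2) 0 0"
    unfolding nu_def sg_el el_mult el_eq_iff by (intro conjI; Groebner_Basis.algebra)
  moreover have "nm nu = (nu * sg (sg nu)) * sg (nu * sg (sg nu))"
    by (simp add: nm_def sg_mult mult_ac)
  ultimately have "nm nu = el (1/16 * Z\<^sup>2 * D - 1/8 * A * D) (- 1/8 * A\<^sup>2) 0 0
      * sg (el (1/16 * Z\<^sup>2 * D - 1/8 * A * D) (- 1/8 * A\<^sup>2) 0 0)"
    by (simp only:)
  also have "\<dots> = of_rat (depressed_r z)"
    unfolding sg_el el_mult el_of_rat el_eq_iff depressed_r_def quartic_D_def quartic_A_def
    by (intro conjI; Groebner_Basis.algebra)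
  finally show ?thesis .
qed

context
  fixes P Q R :: int
  assumes P: "depressed_p z = of_int (2 * P)" and Q: "depressed_q z = of_int (2 * Q)"
    and R: "depressed_r z = of_int (2 * R)" and odd_R: "odd R"
begin

text \<open>Half of \<open>nu ^ 4\<close>, an algebraic integer because all lower coefficients are
  even.\<close>

definition eps :: complex where "eps = - (of_int P * nu\<^sup>2 + of_int Q * nu + of_int R)"

lemma nu_4_int: "nu ^ 4 + of_int (2 * P) * nu\<^sup>2 + of_int (2 * Q) * nu + of_int (2 * R) = 0"
  using nu_4 unfolding P Q R of_rat_of_int_eq .

lemma nu_4_eps: "nu ^ 4 = 2 * eps"
  using nu_4_int unfolding eps_def of_int_mult of_int_numeral by Groebner_Basis.algebra

lemma algebraic_int_nu: "algebraic_int nu"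
  using nu_4_int by (intro algebraic_int_quartic[of nu 0 "2 * P" "2 * Q" "2 * R"]) simp

lemma algebraic_int_eps: "algebraic_int eps"
  unfolding eps_def using algebraic_int_nu
  by (intro algebraic_int_minus algebraic_int_add algebraic_int_mult algebraic_int_pow algebraic_int_of_int)

text \<open>The norm of \<open>k * nu ^ 3 / 2\<close> is \<open>k ^ 4 * R ^ 3 / 2\<close>, whose
  numerator is odd for odd \<open>k\<close>.\<close>

lemma half_nu_cubed:
  assumes "algebraic_int (of_int k * nu ^ 3 / 2)"
  shows "even k"
proof (rule ccontr)
  assume "odd k"
  define x where "x = of_rat (of_int k / 2) * nu ^ 3"
  have "x = of_int k * nu ^ 3 / 2" by (simp add: x_def of_rat_divide)
  then have "algebraic_int x" using assms by metis
  moreover have "x \<in> L" by (simp add: x_def)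
  ultimately have "algebraic_int (nm x)" by (intro algebraic_int_nm)
  moreover have "nm x = of_rat ((of_int k / 2) ^ 4 * (of_int (2 * R)) ^ 3)"
    unfolding x_def by (simp only: nm_mult L_of_rat L_power nu_in_L nm_of_rat nm_power nm_nu R of_rat_mult of_rat_power)
  ultimately have "(of_int k / 2) ^ 4 * (of_int (2 * R)) ^ 3 \<in> (\<int> :: rat set)"
    using algebraic_int_of_rat by metis
  then obtain n where "(of_int k / 2) ^ 4 * (of_int (2 * R)) ^ 3 = (of_int n :: rat)"
    by (rule Ints_cases)
  then have "(of_int (k ^ 4 * R ^ 3) :: rat) = of_int (2 * n)"
    by (simp add: power_divide power_mult_distrib mult_ac)
  then have "k ^ 4 * R ^ 3 = 2 * n" by (simp only: of_int_eq_iff)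
  then have "even (k ^ 4 * R ^ 3)" by simp
  then show False using \<open>odd k\<close> odd_R by simp
qed

text \<open>As \<open>nu ^ 4 = 2 * eps\<close>, the last term is twice an algebraic integer and can
  be subtracted, which leaves the case of \<open>half_nu_cubed\<close>.\<close>

lemma even_if_double_eq:
  assumes "algebraic_int y" and "algebraic_int q" and "2 * y = of_int k * nu ^ 3 + nu ^ 4 * q"
  shows "even k"
proof -
  have "of_int k * nu ^ 3 / 2 = y - eps * q"
    using assms(3) unfolding nu_4_eps by (simp add: field_simps)
  then show ?thesis
    using half_nu_cubed algebraic_int_diff[OF assms(1) algebraic_int_mult[OF algebraic_int_eps assms(2)]]
    by simp
qed

text \<open>Multiplying \<open>2 * x\<close> by \<open>nu ^ 3\<close> leaves
  \<open>a * nu ^ 3\<close> plus a multiple of \<open>nu ^ 4\<close>, so \<open>a\<close> is even.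
  Subtract its half from \<open>x\<close> and continue with the multipliers \<open>nu ^ 2\<close>,
  \<open>nu\<close> and \<open>1\<close>.\<close>

lemma eisenstein_2_maximal:
  assumes "x \<in> OL" and "2 * x \<in> power_lattice nu"
  shows "x \<in> power_lattice nu"
proof -
  obtain a b c e where x: "2 * x = of_int a + of_int b * nu + of_int c * nu\<^sup>2 + of_int e * nu ^ 3"
    using assms(2) by (rule power_lattice_cases)
  have "algebraic_int x" using assms(1) by (simp add: OL_iff)
  note int = this algebraic_int_nu algebraic_int_of_int algebraic_int_diff algebraic_int_add
    algebraic_int_mult algebraic_int_pow
  have "2 * (x * nu ^ 3) = (2 * x) * nu ^ 3" by simp
  also have "\<dots> = of_int a * nu ^ 3 + nu ^ 4 * (of_int b + of_int c * nu + of_int e * nu\<^sup>2)"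
    unfolding x by Groebner_Basis.algebra
  finally have "even a" by (rule even_if_double_eq[rotated 2]) (intro int)+
  then obtain a' where a: "a = 2 * a'" by (rule evenE)
  have "2 * ((x - of_int a') * nu\<^sup>2) = (2 * x - 2 * of_int a') * nu\<^sup>2" by (simp add: algebra_simps)
  also have "\<dots> = of_int b * nu ^ 3 + nu ^ 4 * (of_int c + of_int e * nu)"
    unfolding x a of_int_mult of_int_numeral by Groebner_Basis.algebra
  finally have "even b" by (rule even_if_double_eq[rotated 2]) (intro int)+
  then obtain b' where b: "b = 2 * b'" by (rule evenE)
  have "2 * ((x - of_int a' - of_int b' * nu) * nu) = (2 * x - 2 * of_int a' - 2 * of_int b' * nu) * nu"
    by (simp add: algebra_simps)
  also have "\<dots> = of_int c * nu ^ 3 + nu ^ 4 * of_int e"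
    unfolding x a b of_int_mult of_int_numeral by Groebner_Basis.algebra
  finally have "even c" by (rule even_if_double_eq[rotated 2]) (intro int)+
  then obtain c' where c: "c = 2 * c'" by (rule evenE)
  have "2 * (x - of_int a' - of_int b' * nu - of_int c' * nu\<^sup>2)
      = 2 * x - 2 * of_int a' - 2 * of_int b' * nu - 2 * of_int c' * nu\<^sup>2"
    by (simp add: algebra_simps)
  also have "\<dots> = of_int e * nu ^ 3 + nu ^ 4 * of_int 0"
    unfolding x a b c of_int_mult of_int_numeral of_int_0 by Groebner_Basis.algebra
  finally have "even e" by (rule even_if_double_eq[rotated 2]) (intro int)+
  then obtain e' where e: "e = 2 * e'" by (rule evenE)
  have "2 * x = 2 * (of_int a' + of_int b' * nu + of_int c' * nu\<^sup>2 + of_int e' * nu ^ 3)"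
    unfolding x a b c e of_int_mult of_int_numeral by Groebner_Basis.algebra
  then have "x = of_int a' + of_int b' * nu + of_int c' * nu\<^sup>2 + of_int e' * nu ^ 3"
    by (rule mult_left_cancel[THEN iffD1, rotated]) simp
  then show ?thesis by (metis power_lattice_I)
qed

lemma OL_eq_power_lattice_nu:
  assumes "squarefree_conditions z"
  shows "OL = power_lattice nu"
proof
  show "OL \<subseteq> power_lattice nu"
    using OL_subset_power_lattice_if_2_maximal[OF eisenstein_2_maximal _ two_power_mult_in_power_lattice[OF assms]] by blast
  show "power_lattice nu \<subseteq> OL"
  proof
    fix y assume y: "y \<in> power_lattice nu"
    then have "y \<in> L" by (auto elim!: power_lattice_cases)
    then show "y \<in> OL" using algebraic_int_power_lattice[OF algebraic_int_nu y] by (simp add: OL_iff)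
  qed
qed

end

text \<open>With \<open>z = 2 * y\<close> one has \<open>D = 8 * m\<close> for the odd number
  \<open>m\<close>, which is also a factor of \<open>R\<close>.\<close>

lemma depressed_coeffs_even:
  assumes "even z"
  obtains P Q R where "depressed_p z = of_int (2 * P)" "depressed_q z = of_int (2 * Q)" "depressed_r z = of_int (2 * R)" "odd R"
proof -
  obtain y where y: "z = 2 * y" using assms by (rule evenE)
  define m where "m = 2 * y ^ 4 - 2 * y\<^sup>2 + 1"
  show ?thesis
  proof
    show "depressed_p z = of_int (2 * (- m * (6 * y\<^sup>2 - 2)))"
      unfolding depressed_p_def quartic_D_def quartic_A_def y m_def of_int_add of_int_diff of_int_mult of_int_power of_int_numeral of_int_minus of_int_1
      by Groebner_Basis.algebra
    show "depressed_q z = of_int (2 * (- m * (4 * y\<^sup>2 - 2)\<^sup>2 * y))"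
      unfolding depressed_q_def quartic_D_def quartic_A_def y m_def of_int_add of_int_diff of_int_mult of_int_power of_int_numeral of_int_minus of_int_1
      by Groebner_Basis.algebra
    show "depressed_r z = of_int (2 * (m * (1 - 10 * y ^ 4 + 20 * y ^ 6 - 12 * y ^ 8)))"
      unfolding depressed_r_def quartic_D_def quartic_A_def y m_def of_int_add of_int_diff of_int_mult of_int_power of_int_numeral of_int_minus of_int_1
      by Groebner_Basis.algebra
    show "odd (m * (1 - 10 * y ^ 4 + 20 * y ^ 6 - 12 * y ^ 8))"
      by (simp add: m_def)
  qed
qed

section \<open>Odd \<open>z\<close>: the trace form modulo 2\<close>

definition theta :: complex where "theta = nu + of_rat (1/4 * of_int z)"

lemma theta_in_L [simp]: "theta \<in> L"
  by (simp add: theta_def)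

context
  fixes c2 c1 c0 :: int
  assumes quartic: "quartic z = [:of_int c0, of_int c1, of_int c2, - of_int z, 1:]"
    and odd_coeffs: "odd z" "odd c0" "odd c1" "odd c2"
begin

lemma theta_4: "theta ^ 4 = of_int z * theta ^ 3 - of_int c2 * theta\<^sup>2 - of_int c1 * theta - of_int c0"
  using quartic_root unfolding theta_def[symmetric] quartic
  by (simp add: map_poly_pCons of_rat_minus algebra_simps power_numeral_reduce eq_diff_eq)

lemma algebraic_int_theta: "algebraic_int theta"
  by (rule algebraic_int_quartic[of theta "- z" c2 c1 c0]) (simp add: theta_4)

lemma coeffs_conv: "of_int c2 = depressed_p z + 3/8 * Z\<^sup>2" "of_int c1 = depressed_q z - 1/2 * Z * depressed_p z - 1/16 * Z ^ 3"
proof -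
  have "of_int c2 = depressed_p z + 6 * (- 1/4 * Z)\<^sup>2" "of_int c1 = depressed_q z + 2 * depressed_p z * (- 1/4 * Z) + 4 * (- 1/4 * Z) ^ 3"
    using quartic unfolding quartic_conv_depressed pcompose_depressed_quartic by simp_all
  then show "of_int c2 = depressed_p z + 3/8 * Z\<^sup>2" "of_int c1 = depressed_q z - 1/2 * Z * depressed_p z - 1/16 * Z ^ 3"
    by (simp_all add: power2_eq_square power3_eq_cube)
qed

text \<open>Newton's formulas for the first power sums of the roots, checked in coordinates.\<close>

lemma tr_theta_powers:
  shows "tr (theta ^ 0) = of_int 4" and "tr (theta ^ 1) = of_int z" and "tr (theta ^ 2) = of_int (z\<^sup>2 - 2 * c2)"
    and "tr (theta ^ 3) = of_int (z ^ 3 - 3 * z * c2 - 3 * c1)"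
proof -
  have 0: "theta ^ 0 = of_rat 1 + of_rat 0 * nu + of_rat 0 * nu\<^sup>2 + of_rat 0 * nu ^ 3" by simp
  show "tr (theta ^ 0) = of_int 4" unfolding 0 tr_comb by simp
  have 1: "theta ^ 1 = of_rat (1/4 * Z) + of_rat 1 * nu + of_rat 0 * nu\<^sup>2 + of_rat 0 * nu ^ 3"
    by (simp add: theta_def)
  show "tr (theta ^ 1) = of_int z" unfolding 1 tr_comb by simp
  have 2: "theta ^ 2 = of_rat ((1/4 * Z)\<^sup>2) + of_rat (2 * (1/4 * Z)) * nu + of_rat 1 * nu\<^sup>2 + of_rat 0 * nu ^ 3"
    unfolding theta_def of_rat_power of_rat_mult[of 2] by (simp add: algebra_simps power2_eq_square)
  have i: "(of_int k :: complex) = of_rat (of_int k)" for k by simp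
  show "tr (theta ^ 2) = of_int (z\<^sup>2 - 2 * c2)"
    unfolding 2 tr_comb i of_rat_eq_iff of_int_diff of_int_mult of_int_power of_int_numeral coeffs_conv
      depressed_p_def quartic_D_def quartic_A_def
    by Groebner_Basis.algebra
  have 3: "theta ^ 3 = of_rat ((1/4 * Z) ^ 3) + of_rat (3 * (1/4 * Z)\<^sup>2) * nu + of_rat (3 * (1/4 * Z)) * nu\<^sup>2 + of_rat 1 * nu ^ 3"
    unfolding theta_def of_rat_power of_rat_mult[of 3] by (simp add: algebra_simps power2_eq_square power3_eq_cube)
  show "tr (theta ^ 3) = of_int (z ^ 3 - 3 * z * c2 - 3 * c1)"
    unfolding 3 tr_comb i of_rat_eq_iff of_int_diff of_int_mult of_int_power of_int_numeral coeffs_conv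
      depressed_p_def depressed_q_def quartic_D_def quartic_A_def
    by Groebner_Basis.algebra
qed

text \<open>Multiply the quartic equation by \<open>theta ^ n\<close> and take traces.\<close>

lemma tr_theta_rec:
  assumes "tr (theta ^ n) = of_int s0" "tr (theta ^ (n + 1)) = of_int s1"
    "tr (theta ^ (n + 2)) = of_int s2" "tr (theta ^ (n + 3)) = of_int s3"
  shows "tr (theta ^ (n + 4)) = of_int (z * s3 - c2 * s2 - c1 * s1 - c0 * s0)"
proof -
  have "theta ^ (n + 4) = theta ^ n * theta ^ 4" by (rule power_add)
  also have "\<dots> = of_int z * theta ^ (n + 3) + of_int (- c2) * theta ^ (n + 2) + of_int (- c1) * theta ^ (n + 1) + of_int (- c0) * theta ^ n"
    unfolding theta_4 by (simp add: power_add algebra_simps power2_eq_square power3_eq_cube)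
  finally have "tr (theta ^ (n + 4)) = of_int z * tr (theta ^ (n + 3)) + of_int (- c2) * tr (theta ^ (n + 2))
      + of_int (- c1) * tr (theta ^ (n + 1)) + of_int (- c0) * tr (theta ^ n)"
    by (simp only: tr_add tr_of_int_mult L_add L_mult L_of_int L_power theta_in_L)
  then show ?thesis using assms by simp
qed

text \<open>Pairing \<open>2 * x\<close> with \<open>1, theta, theta^2, theta^3\<close> under the
  trace gives four even integers. The power sums \<open>s 0, ..., s 6\<close> have parities 0, 1, 1,
  1, 1, 0, 1, and the resulting linear system over the field with two elements is invertible, so all
  coefficients of \<open>2 * x\<close> are even.\<close>

lemma unramified_2_maximal:
  assumes "x \<in> OL" and "2 * x \<in> power_lattice theta"
  shows "x \<in> power_lattice theta"
proof -
  \<comment> \<open>The power sums as integers. That an integer value exists for every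
    \<open>n\<close> is the induction below, carried over four consecutive terms to match the
    recurrence.\<close>
  define s where "s = (\<lambda>n::nat. SOME k. tr (theta ^ n) = of_int k)"
  have s: "s n = k" if "tr (theta ^ n) = of_int k" for n k
    unfolding s_def using that by (intro some_equality) auto
  have s0: "s 0 = 4" and s1: "s 1 = z" and s2: "s 2 = z\<^sup>2 - 2 * c2" and s3: "s 3 = z ^ 3 - 3 * z * c2 - 3 * c1"
    using tr_theta_powers by (auto intro: s)
  have ts: "tr (theta ^ n) = of_int (s n) \<and> tr (theta ^ (n + 1)) = of_int (s (n + 1))
      \<and> tr (theta ^ (n + 2)) = of_int (s (n + 2)) \<and> tr (theta ^ (n + 3)) = of_int (s (n + 3))" for n
  proof (induction n)
    case 0
    show ?case unfolding add_0 s0 s1 s2 s3 using tr_theta_powers by blast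
  next
    case (Suc n)
    have "tr (theta ^ (n + 4)) = of_int (s (n + 4))" using tr_theta_rec Suc s by metis
    then show ?case using Suc by (simp add: numeral_eq_Suc)
  qed
  have rec: "s (n + 4) = z * s (n + 3) - c2 * s (n + 2) - c1 * s (n + 1) - c0 * s n" for n
    using tr_theta_rec ts by (intro s) blast
  have par: "even (s 0)" "odd (s 1)" "odd (s 2)" "odd (s 3)"
    unfolding s0 s1 s2 s3 using odd_coeffs by simp_all
  have par4: "odd (s 4)" using rec[of 0] odd_coeffs par by (simp add: numeral_eq_Suc)
  have par5: "even (s 5)" using rec[of 1] odd_coeffs par par4 by (simp add: numeral_eq_Suc)
  have par6: "odd (s 6)" using rec[of 2] odd_coeffs par par4 par5 by (simp add: numeral_eq_Suc)
  obtain a b c e where x: "2 * x = of_int a + of_int b * theta + of_int c * theta\<^sup>2 + of_int e * theta ^ 3"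
    using assms(2) by (rule power_lattice_cases)
  have L: "x \<in> L" and alg: "algebraic_int x" using assms(1) by (simp_all add: OL_iff)
  have ev: "even (a * s n + b * s (n + 1) + c * s (n + 2) + e * s (n + 3))" for n
  proof -
    have "algebraic_int (tr (x * theta ^ n))"
      using L alg algebraic_int_theta by (intro algebraic_int_tr algebraic_int_mult algebraic_int_pow) simp_all
    moreover obtain r where r: "tr (x * theta ^ n) = of_rat r"
      using L_mult[OF L L_power[OF theta_in_L, of n]] by (metis L_cases tr_el)
    ultimately have "r \<in> \<int>" using algebraic_int_of_rat by metis
    then obtain k where k: "r = of_int k" by (rule Ints_cases)
    have "of_int 2 * (x * theta ^ n) = of_int a * theta ^ n + of_int b * theta ^ (n + 1) + of_int c * theta ^ (n + 2) + of_int e * theta ^ (n + 3)"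
      using arg_cong[OF x, of "\<lambda>y. y * theta ^ n"]
      by (simp add: power_add algebra_simps power2_eq_square power3_eq_cube)
    then have "tr (of_int 2 * (x * theta ^ n)) = tr (of_int a * theta ^ n + of_int b * theta ^ (n + 1) + of_int c * theta ^ (n + 2) + of_int e * theta ^ (n + 3))"
      by (rule arg_cong)
    then have "of_int 2 * tr (x * theta ^ n) = of_int a * tr (theta ^ n) + of_int b * tr (theta ^ (n + 1))
        + of_int c * tr (theta ^ (n + 2)) + of_int e * tr (theta ^ (n + 3))"
      by (simp only: tr_add tr_of_int_mult L_add L_mult L_of_int L_power theta_in_L L)
    then have "(of_int (2 * k) :: complex) = of_int (a * s n + b * s (n + 1) + c * s (n + 2) + e * s (n + 3))"
      using ts[of n] by (simp add: r k)
    then have "2 * k = a * s n + b * s (n + 1) + c * s (n + 2) + e * s (n + 3)"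
      by (simp only: of_int_eq_iff)
    then show ?thesis by (metis dvd_triv_left)
  qed
  \<comment> \<open>Comparing the second of these congruences with the first, third and fourth
    isolates \<open>a\<close>, \<open>e\<close> and \<open>c\<close>.\<close>
  have "even (b + c + e)" using ev[of 0] par by (simp add: numeral_eq_Suc)
  moreover have "even (a + b + c + e)" using ev[of 1] par par4 by (simp add: numeral_eq_Suc)
  moreover have "even (a + b + c)" using ev[of 2] par par4 par5 by (simp add: numeral_eq_Suc)
  moreover have "even (a + b + e)" using ev[of 3] par par4 par5 par6 by (simp add: numeral_eq_Suc)
  ultimately have "even a \<and> even b \<and> even c \<and> even e" by presburger
  then obtain a' b' c' e' where abce: "a = 2 * a'" "b = 2 * b'" "c = 2 * c'" "e = 2 * e'"
    by (auto elim!: evenE)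
  have "2 * x = 2 * (of_int a' + of_int b' * theta + of_int c' * theta\<^sup>2 + of_int e' * theta ^ 3)"
    unfolding x abce of_int_mult of_int_numeral by Groebner_Basis.algebra
  then have "x = of_int a' + of_int b' * theta + of_int c' * theta\<^sup>2 + of_int e' * theta ^ 3"
    by (rule mult_left_cancel[THEN iffD1, rotated]) simp
  then show ?thesis by (metis power_lattice_I)
qed

lemma OL_eq_power_lattice_theta_odd:
  assumes "squarefree_conditions z"
  shows "OL = power_lattice theta"
proof
  \<comment> \<open>The exponent is \<open>10 + 6\<close>: passing from \<open>nu\<close> to
    \<open>theta\<close> costs \<open>64 = 2 ^ 6\<close>.\<close>
  have "2 ^ 16 * x \<in> power_lattice theta" if "x \<in> OL" for x
  proof -
    have "64 * (2 ^ 10 * x) \<in> power_lattice (nu + of_int z / 4)"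
      by (rule power_lattice_quarter_shift[OF two_power_mult_in_power_lattice[OF assms that]])
    then show ?thesis by (simp add: theta_def of_rat_divide)
  qed
  then show "OL \<subseteq> power_lattice theta"
    using OL_subset_power_lattice_if_2_maximal[OF unramified_2_maximal] by blast
  show "power_lattice theta \<subseteq> OL"
  proof
    fix y assume y: "y \<in> power_lattice theta"
    then have "y \<in> L" by (auto elim!: power_lattice_cases)
    then show "y \<in> OL" using algebraic_int_power_lattice[OF algebraic_int_theta y] by (simp add: OL_iff)
  qed
qed

end

end

section \<open>Integrality of the coefficients\<close>

lemma quartic_odd:
  assumes "odd z"
  obtains c2 c1 c0 where "quartic z = [:of_int c0, of_int c1, of_int c2, - of_int z, 1:]"
    and "odd c0" "odd c1" "odd c2"
proof -
  obtain k where k: "z = 2 * k + 1" using assms by (rule oddE)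
  \<comment> \<open>An odd square is 1 modulo 8: \<open>T\<close> is the triangular number with
    \<open>z\<^sup>2 = 1 + 8 * T\<close>.\<close>
  have "even (k * (k + 1))" by simp
  then obtain T where T: "k * (k + 1) = 2 * T" by (rule evenE)
  have "z\<^sup>2 = 1 + 4 * (k * (k + 1))" unfolding k by Groebner_Basis.algebra
  then have z2: "z\<^sup>2 = 1 + 8 * T" using T by simp
  define W U :: rat where "W = of_int z" and "U = of_int T"
  have W2: "W\<^sup>2 = 1 + 8 * U" using arg_cong[OF z2, of rat_of_int] by (simp add: W_def U_def)
  have "W ^ 4 = (W\<^sup>2)\<^sup>2" "W ^ 6 = (W\<^sup>2) ^ 3" "W ^ 8 = (W\<^sup>2) ^ 4" "W ^ 10 = (W\<^sup>2) ^ 5" "W ^ 12 = (W\<^sup>2) ^ 6"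
    "W ^ 3 = W * W\<^sup>2" "W ^ 5 = W * (W\<^sup>2)\<^sup>2" "W ^ 7 = W * (W\<^sup>2) ^ 3" "W ^ 9 = W * (W\<^sup>2) ^ 4"
    by Groebner_Basis.algebra+
  note Wpow = this[unfolded W2]
  \<comment> \<open>The coefficients after replacing \<open>z\<^sup>2\<close> by
    \<open>1 + 8 * T\<close>: in each polynomial in \<open>T\<close> only the constant term is odd,
    and the factor \<open>z\<close> of \<open>c1\<close> is odd as well.\<close>
  define c2 c1 c0 where "c2 = - 192 * T ^ 3 + 56 * T\<^sup>2 - 14 * T + 1"
    and "c1 = z * (- 512 * T ^ 4 + 352 * T ^ 3 - 108 * T\<^sup>2 + 20 * T - 1)"
    and "c0 = - 3072 * T ^ 6 + 2816 * T ^ 5 - 944 * T ^ 4 + 120 * T ^ 3 + 20 * T\<^sup>2 - 10 * T + 1"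
  have c: "of_int c2 = - 192 * U ^ 3 + 56 * U\<^sup>2 - 14 * U + 1"
    "of_int c1 = W * (- 512 * U ^ 4 + 352 * U ^ 3 - 108 * U\<^sup>2 + 20 * U - 1)"
    "of_int c0 = - 3072 * U ^ 6 + 2816 * U ^ 5 - 944 * U ^ 4 + 120 * U ^ 3 + 20 * U\<^sup>2 - 10 * U + 1"
    by (simp_all add: c2_def c1_def c0_def W_def U_def)
  have "quartic z = [:of_int c0, of_int c1, of_int c2, - of_int z, 1:]"
    unfolding quartic_def Let_def W_def[symmetric] c Wpow W2 pCons_eq_iff
    by (intro conjI refl; Groebner_Basis.algebra)
  moreover have "odd c0" "odd c1" "odd c2"
    using assms by (simp_all add: c0_def c1_def c2_def)
  ultimately show ?thesis using that by blast
qed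

lemma integral_poly_of_int: "integral_poly [:of_int a, of_int b, of_int c, of_int e, 1:]"
  unfolding integral_poly_def by (rule exI[of _ "[:a, b, c, e, 1:]"]) (simp add: map_poly_pCons)

lemma integral_poly_shifted_depressed:
  assumes "even z"
  shows "integral_poly (pcompose [:depressed_r z, depressed_q z, depressed_p z, 0, 1:] [:of_int h, 1:])"
proof -
  \<comment> \<open>The parity of the depressed coefficients was established in the locale, so some
    pair of square roots is fixed to enter it.\<close>
  obtain d w where "cyclic_quartic z d w" using ex_cyclic_quartic by blast
  then interpret cyclic_quartic z d w .
  obtain P Q R where PQR: "depressed_p z = of_int (2 * P)" "depressed_q z = of_int (2 * Q)" "depressed_r z = of_int (2 * R)"
    using depressed_coeffs_even[OF assms] by blast
  have "pcompose [:depressed_r z, depressed_q z, depressed_p z, 0, 1:] [:of_int h, 1:] =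
    [:of_int (2 * R + 2 * Q * h + 2 * P * h\<^sup>2 + h ^ 4), of_int (2 * Q + 2 * (2 * P) * h + 4 * h ^ 3),
      of_int (2 * P + 6 * h\<^sup>2), of_int (4 * h), 1:]"
    unfolding pcompose_depressed_quartic PQR by simp
  then show ?thesis by (simp only: integral_poly_of_int)
qed

text \<open>For \<open>z = 4 * k\<close> the translation by \<open>- z/4\<close> is integral and the
  depressed quartic has integer coefficients.\<close>

lemma integral_quartic:
  assumes "\<not> [z = 2] (mod 4)"
  shows "integral_poly (quartic z)"
proof (cases "even z")
  case True
  then have "z mod 4 = 0" using assms by (simp add: cong_def) presburger
  then obtain k where k: "z = 4 * k" by auto
  then have "[:- 1/4 * of_int z, 1:] = [:of_int (- k), 1 :: rat:]" by simp
  then show ?thesis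
    using integral_poly_shifted_depressed[OF True, of "- k"] by (simp only: quartic_conv_depressed)
next
  case False
  then obtain c2 c1 c0 where "quartic z = [:of_int c0, of_int c1, of_int c2, - of_int z, 1:]"
    by (rule quartic_odd)
  then show ?thesis using integral_poly_of_int[of c0 c1 c2 "- z"] by simp
qed

text \<open>With \<open>z = 4 * k + 2\<close> the translations by \<open>- z/4\<close> and
  \<open>- 1/2\<close> add up to the integer \<open>- k - 1\<close>.\<close>

lemma integral_quartic_shift:
  assumes "[z = 2] (mod 4)"
  shows "integral_poly (pcompose (quartic z) [:- 1/2, 1:])"
proof -
  have "z mod 4 = 2" using assms by (simp add: cong_def)
  then obtain k where k: "z = 4 * k + 2" by (metis mult_div_mod_eq)
  then have "even z" by simp
  have "pcompose [:- 1/4 * of_int z, 1:] [:- 1/2, 1:] = [:of_int (- k - 1), 1 :: rat:]"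
    by (simp add: pcompose_pCons k)
  then have "pcompose (quartic z) [:- 1/2, 1:] = pcompose [:depressed_r z, depressed_q z, depressed_p z, 0, 1:] [:of_int (- k - 1), 1:]"
    unfolding quartic_conv_depressed pcompose_assoc[symmetric] by (simp only:)
  then show ?thesis using integral_poly_shifted_depressed[OF \<open>even z\<close>] by (simp only:)
qed

section \<open>Integral bases and monogeneity\<close>

context cyclic_quartic
begin

text \<open>For \<open>z = 4 * k\<close> the root \<open>theta\<close> differs from
  \<open>nu\<close> by an integer, so the Eisenstein case applies; odd \<open>z\<close> is the trace
  form case.\<close>

lemma OL_eq_power_lattice_theta:
  assumes "squarefree_conditions z" and "\<not> [z = 2] (mod 4)"
  shows "OL = power_lattice theta"
proof (cases "even z")
  case True
  then have "z mod 4 = 0" using assms(2) by (simp add: cong_def) presburger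
  then obtain k where k: "z = 4 * k" by auto
  have "theta = nu + of_int k" unfolding theta_def by (simp add: k)
  moreover have "OL = power_lattice nu"
    using depressed_coeffs_even[OF True] OL_eq_power_lattice_nu assms(1) by metis
  ultimately show ?thesis by (simp add: power_lattice_shift)
next
  case False
  then show ?thesis using quartic_odd OL_eq_power_lattice_theta_odd assms(1) by metis
qed

text \<open>Here \<open>z/4 = k + 1/2\<close>, so the extra \<open>1/2\<close> makes the distance to
  \<open>nu\<close> an integer and the Eisenstein case applies.\<close>

lemma OL_eq_power_lattice_theta_shift:
  assumes "squarefree_conditions z" and "[z = 2] (mod 4)"
  shows "OL = power_lattice (theta + 1/2)"
proof -
  have "z mod 4 = 2" using assms(2) by (simp add: cong_def)
  then obtain k where k: "z = 4 * k + 2" by (metis mult_div_mod_eq)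
  then have "even z" by simp
  have "theta + 1/2 = nu + of_int (k + 1)" 
    unfolding theta_def by (simp add: k of_rat_add of_rat_divide)
  moreover have "OL = power_lattice nu"
    using depressed_coeffs_even[OF \<open>even z\<close>] OL_eq_power_lattice_nu assms(1) by metis
  ultimately show ?thesis by (simp only: power_lattice_shift)
qed

lemma adjoin_theta: "adjoin {theta} = L" and adjoin_theta_shift: "adjoin {theta + 1/2} = L"
proof -
  show "adjoin {theta} = L" by (rule adjoin_eq_L[of "1/4 * of_int z"]) (simp_all add: theta_def)
  have h: "theta + 1/2 = nu + of_rat (1/4 * of_int z + 1/2)"
    by (simp add: theta_def of_rat_add of_rat_divide)
  show "adjoin {theta + 1/2} = L"
    by (rule adjoin_eq_L[of "1/4 * of_int z + 1/2"]) (simp_all only: h singletonI L_add L_of_rat nu_in_L empty_subsetI insert_subset simp_thms)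
qed

lemma rat_indep_theta: "rat_indep theta" and rat_indep_theta_shift: "rat_indep (theta + 1/2)"
proof -
  show "rat_indep theta" unfolding theta_def by (rule rat_indep_shift[OF rat_indep_nu])
  from rat_indep_shift[OF this, of "1/2"] show "rat_indep (theta + 1/2)" by (simp add: of_rat_divide)
qed

lemma int_basis_theta:
  assumes "squarefree_conditions z" and "\<not> [z = 2] (mod 4)"
  shows "int_basis [1, theta, theta\<^sup>2, theta ^ 3] OL"
  unfolding OL_eq_power_lattice_theta[OF assms] by (rule int_basis_power_lattice[OF rat_indep_theta])

lemma int_basis_theta_shift:
  assumes "squarefree_conditions z" and "[z = 2] (mod 4)"
  shows "int_basis [1, theta + 1/2, (theta + 1/2)\<^sup>2, (theta + 1/2) ^ 3] OL"
  unfolding OL_eq_power_lattice_theta_shift[OF assms] by (rule int_basis_power_lattice[OF rat_indep_theta_shift])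

text \<open>The generator is \<open>theta\<close> or \<open>theta + 1/2\<close>, according to
  \<open>z\<close> modulo 4; its integrality is read off from its being a basis element.\<close>

lemma monogenic_L:
  assumes "squarefree_conditions z"
  shows "monogenic L"
proof -
  have "\<exists>x. int_basis [1, x, x\<^sup>2, x ^ 3] OL"
    using int_basis_theta int_basis_theta_shift assms by blast
  then obtain x where x: "int_basis [1, x, x\<^sup>2, x ^ 3] OL" by blast
  then have "x \<in> OL"
    unfolding int_basis_def using int_mod.span_base[of x "set [1, x, x\<^sup>2, x ^ 3]"] by auto
  moreover have "map (\<lambda>i. x ^ i) [0..<field_degree L] = [1, x, x\<^sup>2, x ^ 3]"
    by (simp add: field_degree_L upt_rec numeral_eq_Suc)
  ultimately show ?thesis unfolding monogenic_def using number_field_L x by metis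
qed

end

theorem theorem1p1:
  fixes z :: int
  shows
    "(Factorial_Ring.irreducible (quartic z) \<and>
      group (galois_group (quartic z)) \<and>
      cyclic_group (galois_group (quartic z)) \<and>
      Coset.order (galois_group (quartic z)) = 4 \<and>
      (squarefree_conditions z \<longrightarrow>
        (\<forall>\<theta> :: complex. poly (map_poly of_rat (quartic z)) \<theta> = 0 \<longrightarrow>
          monogenic (adjoin {\<theta>}))))
     \<and>
     (\<not> [z = 2] (mod 4) \<longrightarrow>
      integral_poly (quartic z) \<and>
      (squarefree_conditions z \<longrightarrow>
        (\<forall>\<theta> :: complex. poly (map_poly of_rat (quartic z)) \<theta> = 0 \<longrightarrow>
          int_basis [1, \<theta>, \<theta>^2, \<theta>^3] (ring_of_integers (adjoin {\<theta>})))))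
     \<and>
     ([z = 2] (mod 4) \<longrightarrow>
      integral_poly (pcompose (quartic z) [:-1/2, 1:]) \<and>
      (\<forall>\<theta> \<theta>\<^sub>1 :: complex.
        poly (map_poly of_rat (quartic z)) \<theta> = 0 \<and> \<theta>\<^sub>1 = \<theta> + 1/2 \<longrightarrow>
          poly (map_poly of_rat (pcompose (quartic z) [:-1/2, 1:])) \<theta>\<^sub>1 = 0 \<and>
          (squarefree_conditions z \<longrightarrow>
            int_basis [1, \<theta>\<^sub>1, \<theta>\<^sub>1^2, \<theta>\<^sub>1^3] (ring_of_integers (adjoin {\<theta>\<^sub>1})))))"
proof (intro conjI impI allI; (elim conjE)?)
  \<comment> \<open>Square roots exist in the complex numbers, so some pair \<open>d, w\<close> is
    available.\<close>
  obtain d w where "cyclic_quartic z d w" using ex_cyclic_quartic by blast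
  then interpret cyclic_quartic z d w .
  show "Factorial_Ring.irreducible (quartic z)" by (rule irreducible_quartic)
  show "group (galois_group (quartic z))" by (rule group_G)
  show "cyclic_group (galois_group (quartic z))" by (rule cyclic_group_G)
  show "Coset.order (galois_group (quartic z)) = 4" by (rule order_G)
next
  fix \<theta> :: complex
  assume sf: "squarefree_conditions z" and "poly (map_poly of_rat (quartic z)) \<theta> = 0"
  \<comment> \<open>The given root determines its own \<open>d\<close> and \<open>w\<close>, for
    which it is the \<open>theta\<close> of the locale.\<close>
  then obtain d w where cq: "cyclic_quartic z d w"
    and \<theta>: "\<theta> = cyclic_quartic.nu z d w + of_rat (1/4 * of_int z)" by (blast elim: quartic_root_cases)
  interpret cyclic_quartic z d w by (rule cq)
  show "monogenic (adjoin {\<theta>})"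
    unfolding \<theta> theta_def[symmetric] adjoin_theta by (rule monogenic_L[OF sf])
next
  assume "\<not> [z = 2] (mod 4)"
  then show "integral_poly (quartic z)" by (rule integral_quartic)
next
  fix \<theta> :: complex
  assume z: "\<not> [z = 2] (mod 4)" and sf: "squarefree_conditions z"
    and "poly (map_poly of_rat (quartic z)) \<theta> = 0"
  then obtain d w where cq: "cyclic_quartic z d w"
    and \<theta>: "\<theta> = cyclic_quartic.nu z d w + of_rat (1/4 * of_int z)" by (blast elim: quartic_root_cases)
  interpret cyclic_quartic z d w by (rule cq)
  show "int_basis [1, \<theta>, \<theta>^2, \<theta>^3] (ring_of_integers (adjoin {\<theta>}))"
    unfolding \<theta> theta_def[symmetric] adjoin_theta by (rule int_basis_theta[OF sf z])
next
  assume "[z = 2] (mod 4)"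
  then show "integral_poly (pcompose (quartic z) [:-1/2, 1:])" by (rule integral_quartic_shift)
next
  fix \<theta> \<theta>\<^sub>1 :: complex
  assume "poly (map_poly of_rat (quartic z)) \<theta> = 0" and "\<theta>\<^sub>1 = \<theta> + 1/2"
  then show "poly (map_poly of_rat (pcompose (quartic z) [:-1/2, 1:])) \<theta>\<^sub>1 = 0"
    unfolding poly_of_rat_pcompose by (simp add: map_poly_pCons of_rat_minus of_rat_divide)
next
  fix \<theta> \<theta>\<^sub>1 :: complex
  assume z: "[z = 2] (mod 4)" and sf: "squarefree_conditions z"
    and "poly (map_poly of_rat (quartic z)) \<theta> = 0" and \<theta>1: "\<theta>\<^sub>1 = \<theta> + 1/2"
  then obtain d w where cq: "cyclic_quartic z d w"
    and \<theta>: "\<theta> = cyclic_quartic.nu z d w + of_rat (1/4 * of_int z)" by (blast elim: quartic_root_cases)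
  interpret cyclic_quartic z d w by (rule cq)
  show "int_basis [1, \<theta>\<^sub>1, \<theta>\<^sub>1^2, \<theta>\<^sub>1^3] (ring_of_integers (adjoin {\<theta>\<^sub>1}))"
    unfolding \<theta>1 \<theta> theta_def[symmetric] adjoin_theta_shift by (rule int_basis_theta_shift[OF sf z])
qed

end
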